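(* Let $(A_i)_i$ and $(A'_i)_i$ be two $k$-valued points of $\mathcal A_I$. For $0\le j\le i\le g$ denote by $\alpha_{ji}\colon H^1_{DR}(A_i)\to H^1_{DR}(A_j)$ the natural map, by $\omega(A_i)\subset H^1_{DR}(A_i)$ the Hodge filtration, and by ${}^\perp$ the orthogonal complement inside $H^1_{DR}(A_0)$ with respect to the pairing induced by the principal polarization of $A_0$; use analogous notation $\alpha'_{ji}$, $\omega(A'_i)$, ${}^\perp$ for $(A'_i)_i$. Then $(A_i)_i$ and $(A'_i)_i$ lie in the same Kottwitz–Rapoport stratum if and only if for all $0\le j<i\le g$ $$\dim \omega(A_j)/\alpha_{ji}(\omega(A_i)) = \dim \omega(A'_j)/\alpha'_{ji}(\omega(A'_i)),$$ $$\dim H^1_{DR}(A_j)/\bigl(\omega(A_j)+\alpha_{ji}(H^1_{DR}(A_i))\bigr) = \dim H^1_{DR}(A'_j)/\bigl(\omega(A'_j)+\alpha'_{ji}(H^1_{DR}(A'_i))\bigr),$$ and for all $0\le i,j\le g$ $$\dim\bigl(\alpha_{0i}(\omega(A_i))+\alpha_{0j}(H^1_{DR}(A_j))^\perp\bigr)=\dim\bigl(\alpha'_{0i}(\omega(A'_i))+\alpha'_{0j}(H^1_{DR}(A'_j))^\perp\bigr).$$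
   Context: Let $p$ be a prime, $g\ge 1$, $N\ge 3$ an integer prime to $p$, $k=\overline{\mathbb F}_p$, $I=\{0,1,\dots,g\}$, and fix a primitive $N$-th root of unity $\zeta_N$. $\mathcal A_I$ is the moduli space over $k$ of isomorphism classes of chains $(A_0\to A_1\to\cdots\to A_g,\lambda_0,\lambda_g,\eta)$, where the $A_i$ are $g$-dimensional abelian varieties, the maps $A_i\to A_{i+1}$ are isogenies of degree $p$, $\lambda_0,\lambda_g$ are principal polarizations of $A_0,A_g$ such that the pull-back of $\lambda_g$ to $A_0$ is $p\lambda_0$, and $\eta$ is a symplectic level-$N$ structure on $A_0$ (with respect to $\zeta_N$). Such a point is abbreviated $(A_i)_i$. Kottwitz–Rapoport (KR) strata. On $V=\mathbb Q_p^{2g}$ with standard basis $e_1,\dots,e_{2g}$ let $\psi$ be the alternating form whose only non-zero pairings are $\psi(e_i,e_{2g+1-i})=1$ for $1\le i\le g$ and $\psi(e_i,e_{2g+1-i})=-1$ for $g+1\le i\le 2g$. Let $\Lambda_i=\langle p^{-1}e_1,\dots,p^{-1}e_i,e_{i+1},\dots,e_{2g}\rangle_{\mathbb Z_p}$ for $0\le i<2g$, extended by $\Lambda_{i+2g}=p^{-1}\Lambda_i$. $\Lambda_0$ carries the form $\psi_0=\psi$ and $\Lambda_{-g}$ the form $\psi_{-g}=\frac1p\psi$. For a point $(A_i)_i\in\mathcal A_I(k)$ there is an isomorphism of chains $\xi=(\xi_i)_{0\le i\le g}$, $\xi_i\colon H^1_{DR}(A_i)\simeq \Lambda_{-i}\otimes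 k$, preserving the forms on $H^1_{DR}(A_0)$, $H^1_{DR}(A_g)$ induced by the polarizations up to scalars. Let $\mathcal G_I(k)$ be the group of automorphisms of the chain $(\Lambda_{-g}\otimes k\to\cdots\to\Lambda_0\otimes k)$ preserving $\psi_0$ and $\psi_{-g}$ up to scalars. The $\mathcal G_I(k)$-orbit of the chain of subspaces $(\xi_i(\omega(A_i)))_i$ is independent of $\xi$; two points lie in the same KR stratum if and only if these orbits coincide. *)

theory Defs
  imports
    "HOL-Algebra.Group"
    "HOL-Computational_Algebra.Computational_Algebra"
    "HOL-Library.Function_Algebras"
    "HOL-Library.FuncSet"
begin

section \<open>Linear algebra\<close>

definition linear_on ::
  "('k \<Rightarrow> 'v::ab_group_add \<Rightarrow> 'v) \<Rightarrow> ('k \<Rightarrow> 'w::ab_group_add \<Rightarrow> 'w) \<Rightarrow> 'v set \<Rightarrow> ('v \<Rightarrow> 'w) \<Rightarrow> bool" where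
  "linear_on s t V f \<longleftrightarrow>
     (\<forall>x\<in>V. \<forall>y\<in>V. f (x + y) = f x + f y) \<and> (\<forall>c. \<forall>x\<in>V. f (s c x) = t c (f x))"

definition subspace_sum :: "'v::plus set \<Rightarrow> 'v set \<Rightarrow> 'v set" where
  "subspace_sum U W = {u + w | u w. u \<in> U \<and> w \<in> W}"

text \<open>The dimension of \<open>W / U\<close>; used only for subspaces \<open>U \<subseteq> W\<close> with \<open>W\<close> of finite dimension.\<close>

definition dim_quot :: "('k::field \<Rightarrow> 'v::ab_group_add \<Rightarrow> 'v) \<Rightarrow> 'v set \<Rightarrow> 'v set \<Rightarrow> nat" where
  "dim_quot s W U = vector_space.dim s W - vector_space.dim s U"

definition is_Fp_closure :: "nat \<Rightarrow> 'k::alg_closed_field itself \<Rightarrow> bool" where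
  "is_Fp_closure p _ \<longleftrightarrow> prime p \<and> CHAR('k) = p \<and>
     (\<forall>x::'k. \<exists>q::'k poly. q \<noteq> 0 \<and> (\<forall>i. poly.coeff q i \<in> \<int>) \<and> poly q x = 0)"
  \<comment> \<open>in characteristic \<open>p\<close> the set \<open>\<int>\<close> is the prime field\<close>

definition primitive_root_of_unity :: "nat \<Rightarrow> 'k::field \<Rightarrow> bool" where
  "primitive_root_of_unity N z \<longleftrightarrow> z ^ N = 1 \<and> (\<forall>m. 0 < m \<and> m < N \<longrightarrow> z ^ m \<noteq> 1)"

text \<open>Coordinate vectors of length \<open>2g\<close>, with coordinates numbered \<open>1, \<dots>, 2g\<close>, and the
  standard alternating form on them.\<close>

definition coord_space :: "nat \<Rightarrow> (nat \<Rightarrow> 'r::zero) set" where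
  "coord_space g = {x. \<forall>m. m \<notin> {1..2*g} \<longrightarrow> x m = 0}"

definition coord_smult :: "'r::times \<Rightarrow> (nat \<Rightarrow> 'r) \<Rightarrow> (nat \<Rightarrow> 'r)" where
  "coord_smult c x = (\<lambda>m. c * x m)"

definition std_form :: "nat \<Rightarrow> (nat \<Rightarrow> 'r::comm_ring_1) \<Rightarrow> (nat \<Rightarrow> 'r) \<Rightarrow> 'r" where
  "std_form g x y = (\<Sum>i=1..g. x i * y (2*g + 1 - i)) - (\<Sum>i=g+1..2*g. x i * y (2*g + 1 - i))"


section \<open>Chains of vector spaces with forms at both ends\<close>

text \<open>Spaces \<open>H\<^sub>g \<rightarrow> \<dots> \<rightarrow> H\<^sub>1 \<rightarrow> H\<^sub>0\<close> over \<open>k\<close>, realised as subspaces of one ambient vector space;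
  \<open>ch_map C i\<close> is the map \<open>H\<^sub>i\<^sub>+\<^sub>1 \<rightarrow> H\<^sub>i\<close>, and \<open>ch_form0\<close>, \<open>ch_formg\<close> are forms on
  \<open>H\<^sub>0\<close> and \<open>H\<^sub>g\<close>.\<close>

record ('k, 'v) pol_chain =
  ch_smult :: "'k \<Rightarrow> 'v \<Rightarrow> 'v"
  ch_space :: "nat \<Rightarrow> 'v set"
  ch_map :: "nat \<Rightarrow> 'v \<Rightarrow> 'v"
  ch_form0 :: "'v \<Rightarrow> 'v \<Rightarrow> 'k"
  ch_formg :: "'v \<Rightarrow> 'v \<Rightarrow> 'k"

definition chain_isos ::
  "nat \<Rightarrow> ('k::field, 'v::ab_group_add) pol_chain \<Rightarrow> ('k, 'w::ab_group_add) pol_chain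
     \<Rightarrow> (nat \<Rightarrow> 'v \<Rightarrow> 'w) set" where
  "chain_isos g C D = {\<xi>.
     (\<forall>i\<le>g. linear_on (ch_smult C) (ch_smult D) (ch_space C i) (\<xi> i) \<and>
            bij_betw (\<xi> i) (ch_space C i) (ch_space D i)) \<and>
     (\<forall>i<g. \<forall>x\<in>ch_space C (Suc i). \<xi> i (ch_map C i x) = ch_map D i (\<xi> (Suc i) x)) \<and>
     (\<exists>c. c \<noteq> 0 \<and> (\<forall>x\<in>ch_space C 0. \<forall>y\<in>ch_space C 0.
            ch_form0 D (\<xi> 0 x) (\<xi> 0 y) = c * ch_form0 C x y)) \<and>
     (\<exists>c. c \<noteq> 0 \<and> (\<forall>x\<in>ch_space C g. \<forall>y\<in>ch_space C g.
            ch_formg D (\<xi> g x) (\<xi> g y) = c * ch_formg C x y))}"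


section \<open>The standard lattice chain modulo \<open>p\<close>\<close>

text \<open>\<open>\<Lambda>\<^sub>i\<close> has the basis \<open>lat_scale p g i m \<cdot> e\<^sub>m\<close> (\<open>1 \<le> m \<le> 2g\<close>). For \<open>0 \<le> i < 2g\<close> the factor is
  \<open>p\<^sup>-\<^sup>1\<close> if \<open>m \<le> i\<close> and \<open>1\<close> otherwise; \<open>\<Lambda>\<^bsub>i+2g\<^esub> = p\<^sup>-\<^sup>1 \<Lambda>\<^sub>i\<close> gives the other \<open>i\<close>. The images of
  these vectors form a basis of \<open>\<Lambda>\<^sub>i \<otimes> k\<close>, which is thereby identified with \<open>k\<^bsup>2g\<^esup>\<close>. All
  structure constants are rational numbers with denominator prime to \<open>p\<close>, so one can
  compute in \<open>\<rat>\<close> instead of \<open>\<rat>\<^sub>p\<close> and then reduce.\<close>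

definition lat_scale :: "nat \<Rightarrow> nat \<Rightarrow> int \<Rightarrow> nat \<Rightarrow> rat" where
  "lat_scale p g i m =
     of_nat p powi (- (i div int (2*g)) - (if int m \<le> i mod int (2*g) then 1 else 0))"

definition lat_vec :: "nat \<Rightarrow> nat \<Rightarrow> int \<Rightarrow> nat \<Rightarrow> (nat \<Rightarrow> rat)" where
  "lat_vec p g i m = (\<lambda>n. if n = m then lat_scale p g i m else 0)"

text \<open>The reduction map from the \<open>p\<close>-integral rational numbers to a field of characteristic \<open>p\<close>.\<close>

definition reduce :: "rat \<Rightarrow> 'k::field" where
  "reduce r = of_int (fst (quotient_of r)) / of_int (snd (quotient_of r))"

text \<open>The map \<open>\<Lambda>\<^sub>i \<otimes> k \<rightarrow> \<Lambda>\<^sub>j \<otimes> k\<close> induced by the inclusion \<open>\<Lambda>\<^sub>i \<subseteq> \<Lambda>\<^sub>j\<close> (\<open>i \<le> j\<close>).\<close>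

definition lat_map :: "nat \<Rightarrow> nat \<Rightarrow> int \<Rightarrow> int \<Rightarrow> (nat \<Rightarrow> 'k::field) \<Rightarrow> (nat \<Rightarrow> 'k)" where
  "lat_map p g i j x = (\<lambda>m. reduce (lat_scale p g i m / lat_scale p g j m) * x m)"

text \<open>The form on \<open>\<Lambda>\<^sub>i \<otimes> k\<close> induced by \<open>c \<psi>\<close>, if \<open>c \<psi>\<close> is integral on \<open>\<Lambda>\<^sub>i\<close>.\<close>

definition lat_form ::
  "nat \<Rightarrow> nat \<Rightarrow> int \<Rightarrow> rat \<Rightarrow> (nat \<Rightarrow> 'k::field) \<Rightarrow> (nat \<Rightarrow> 'k) \<Rightarrow> 'k" where
  "lat_form p g i c x y = (\<Sum>m=1..2*g. \<Sum>n=1..2*g.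
     x m * reduce (c * std_form g (lat_vec p g i m) (lat_vec p g i n)) * y n)"

definition lattice_chain :: "nat \<Rightarrow> nat \<Rightarrow> ('k::field, nat \<Rightarrow> 'k) pol_chain" where
  "lattice_chain p g =
     \<lparr> ch_smult = coord_smult,
       ch_space = (\<lambda>i. coord_space g),
       ch_map = (\<lambda>i. lat_map p g (- int (Suc i)) (- int i)),
       ch_form0 = lat_form p g 0 1,
       ch_formg = lat_form p g (- int g) (1 / of_nat p) \<rparr>"

definition G_I :: "nat \<Rightarrow> nat \<Rightarrow> (nat \<Rightarrow> (nat \<Rightarrow> 'k::field) \<Rightarrow> (nat \<Rightarrow> 'k)) set" where
  "G_I p g = chain_isos g (lattice_chain p g) (lattice_chain p g)"

definition G_I_orbit ::
  "nat \<Rightarrow> nat \<Rightarrow> (nat \<Rightarrow> (nat \<Rightarrow> 'k::field) set) \<Rightarrow> (nat \<Rightarrow> (nat \<Rightarrow> 'k) set) set" where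
  "G_I_orbit p g L = (\<lambda>\<gamma>. \<lambda>i\<in>{..g}. \<gamma> i ` L i) ` G_I p g"


section \<open>Abelian varieties and de Rham cohomology\<close>

text \<open>Abelian varieties over \<open>k\<close> and their de Rham cohomology are not available in the
  libraries. The following record collects the primitive notions from which \<open>\<A>\<^sub>I\<close>, the
  Kottwitz--Rapoport strata and the numerical invariants are built:

  \<^item> \<open>AV\<close>, \<open>av_dim\<close>: the abelian varieties over \<open>k\<close> and their dimensions;
  \<^item> \<open>av_points A\<close>: the group \<open>A(k)\<close>;
  \<^item> \<open>isogenies A B\<close>, \<open>isog_degree\<close>: the isogenies \<open>A \<rightarrow> B\<close> and their degrees;
  \<^item> \<open>principal_pols A\<close>: the principal polarizations of \<open>A\<close>, among all polarizations \<open>'l\<close>;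
    \<open>pol_pullback f \<lambda>\<close> is the pull-back of \<open>\<lambda>\<close> along \<open>f\<close> and \<open>pol_mult n \<lambda>\<close> is \<open>n\<lambda>\<close>;
  \<^item> \<open>weil_pairing N A \<lambda>\<close>: the Weil pairing on \<open>A[N](k)\<close> defined by \<open>\<lambda>\<close>;
  \<^item> \<open>H1 A\<close>, \<open>omega A\<close>: the de Rham cohomology \<open>H\<^sup>1\<^sub>D\<^sub>R(A)\<close> and its Hodge filtration
    \<open>\<omega>(A) \<subseteq> H\<^sup>1\<^sub>D\<^sub>R(A)\<close>, all placed inside one ambient \<open>k\<close>-vector space (for instance a direct
    sum) with scalar multiplication \<open>dR_smult\<close>;
  \<^item> \<open>dR_pullback f\<close>: the map \<open>H\<^sup>1\<^sub>D\<^sub>R(B) \<rightarrow> H\<^sup>1\<^sub>D\<^sub>R(A)\<close> induced by \<open>f : A \<rightarrow> B\<close>;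
  \<^item> \<open>dR_pairing A \<lambda>\<close>: the pairing on \<open>H\<^sup>1\<^sub>D\<^sub>R(A)\<close> induced by the principal polarization \<open>\<lambda>\<close>.\<close>

record ('k, 'a, 'm, 'l, 'q, 'v) av_deRham =
  AV :: "'a set"
  av_dim :: "'a \<Rightarrow> nat"
  av_points :: "'a \<Rightarrow> 'q monoid"
  isogenies :: "'a \<Rightarrow> 'a \<Rightarrow> 'm set"
  isog_degree :: "'m \<Rightarrow> nat"
  principal_pols :: "'a \<Rightarrow> 'l set"
  pol_pullback :: "'m \<Rightarrow> 'l \<Rightarrow> 'l"
  pol_mult :: "nat \<Rightarrow> 'l \<Rightarrow> 'l"
  weil_pairing :: "nat \<Rightarrow> 'a \<Rightarrow> 'l \<Rightarrow> 'q \<Rightarrow> 'q \<Rightarrow> 'k"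
  dR_smult :: "'k \<Rightarrow> 'v \<Rightarrow> 'v"
  H1 :: "'a \<Rightarrow> 'v set"
  omega :: "'a \<Rightarrow> 'v set"
  dR_pullback :: "'m \<Rightarrow> 'v \<Rightarrow> 'v"
  dR_pairing :: "'a \<Rightarrow> 'l \<Rightarrow> 'v \<Rightarrow> 'v \<Rightarrow> 'k"

definition av_torsion :: "('k, 'a, 'm, 'l, 'q, 'v) av_deRham \<Rightarrow> nat \<Rightarrow> 'a \<Rightarrow> 'q set" where
  "av_torsion T N A =
     {q \<in> carrier (av_points T A). q [^]\<^bsub>av_points T A\<^esub> N = \<one>\<^bsub>av_points T A\<^esub>}"

text \<open>A symplectic isomorphism \<open>\<eta> : (\<int>/N)\<^bsup>2g\<^esup> \<rightarrow> A[N](k)\<close>, given as a surjective homomorphism on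
  \<open>\<int>\<^bsup>2g\<^esup>\<close> with kernel \<open>N\<int>\<^bsup>2g\<^esup>\<close>; \<open>\<zeta>\<close> identifies \<open>\<int>/N\<close> with the \<open>N\<close>-th roots of unity.\<close>

definition level_structure ::
  "('k::field, 'a, 'm, 'l, 'q, 'v) av_deRham \<Rightarrow> nat \<Rightarrow> nat \<Rightarrow> 'k \<Rightarrow> 'a \<Rightarrow> 'l
     \<Rightarrow> ((nat \<Rightarrow> int) \<Rightarrow> 'q) \<Rightarrow> bool" where
  "level_structure T g N \<zeta> A l \<eta> \<longleftrightarrow>
     (\<forall>x\<in>coord_space g. \<forall>y\<in>coord_space g. \<eta> (x + y) = \<eta> x \<otimes>\<^bsub>av_points T A\<^esub> \<eta> y) \<and>
     \<eta> ` coord_space g = av_torsion T N A \<and>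
     (\<forall>x\<in>coord_space g. \<eta> x = \<one>\<^bsub>av_points T A\<^esub> \<longleftrightarrow> (\<forall>m. int N dvd x m)) \<and>
     (\<forall>x\<in>coord_space g. \<forall>y\<in>coord_space g.
        weil_pairing T N A l (\<eta> x) (\<eta> y) = \<zeta> powi std_form g x y)"

text \<open>A tuple \<open>(A\<^sub>0 \<rightarrow> A\<^sub>1 \<rightarrow> \<dots> \<rightarrow> A\<^sub>g, \<lambda>\<^sub>0, \<lambda>\<^sub>g, \<eta>)\<close> with \<open>pt_isog X i : A\<^sub>i \<rightarrow> A\<^sub>i\<^sub>+\<^sub>1\<close>. It represents a
  point of \<open>\<A>\<^sub>I(k)\<close>, that is, an isomorphism class of such tuples.\<close>

record ('a, 'm, 'l, 'q) AI_tuple =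
  pt_av :: "nat \<Rightarrow> 'a"
  pt_isog :: "nat \<Rightarrow> 'm"
  pt_pol0 :: 'l
  pt_polg :: 'l
  pt_level :: "(nat \<Rightarrow> int) \<Rightarrow> 'q"

definition AI_points ::
  "('k::field, 'a, 'm, 'l, 'q, 'v) av_deRham \<Rightarrow> nat \<Rightarrow> nat \<Rightarrow> nat \<Rightarrow> 'k \<Rightarrow> ('a, 'm, 'l, 'q) AI_tuple set" where
  "AI_points T p g N \<zeta> = {X.
     (\<forall>i\<le>g. pt_av X i \<in> AV T \<and> av_dim T (pt_av X i) = g) \<and>
     (\<forall>i<g. pt_isog X i \<in> isogenies T (pt_av X i) (pt_av X (Suc i)) \<and>
            isog_degree T (pt_isog X i) = p) \<and>
     pt_pol0 X \<in> principal_pols T (pt_av X 0) \<and>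
     pt_polg X \<in> principal_pols T (pt_av X g) \<and>
     foldr (\<lambda>i. pol_pullback T (pt_isog X i)) [0..<g] (pt_polg X) = pol_mult T p (pt_pol0 X) \<and>
     level_structure T g N \<zeta> (pt_av X 0) (pt_pol0 X) (pt_level X)}"

text \<open>\<open>\<alpha>\<^sub>j\<^sub>i : H\<^sup>1\<^sub>D\<^sub>R(A\<^sub>i) \<rightarrow> H\<^sup>1\<^sub>D\<^sub>R(A\<^sub>j)\<close> for \<open>j \<le> i\<close>, induced by \<open>A\<^sub>j \<rightarrow> A\<^sub>j\<^sub>+\<^sub>1 \<rightarrow> \<dots> \<rightarrow> A\<^sub>i\<close>.\<close>

definition alpha ::
  "('k, 'a, 'm, 'l, 'q, 'v) av_deRham \<Rightarrow> ('a, 'm, 'l, 'q) AI_tuple \<Rightarrow> nat \<Rightarrow> nat \<Rightarrow> 'v \<Rightarrow> 'v" where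
  "alpha T X j i = foldr (\<lambda>n. dR_pullback T (pt_isog X n)) [j..<i]"

abbreviation pt_H1 ::
  "('k, 'a, 'm, 'l, 'q, 'v) av_deRham \<Rightarrow> ('a, 'm, 'l, 'q) AI_tuple \<Rightarrow> nat \<Rightarrow> 'v set" where
  "pt_H1 T X i \<equiv> H1 T (pt_av X i)"

abbreviation pt_omega ::
  "('k, 'a, 'm, 'l, 'q, 'v) av_deRham \<Rightarrow> ('a, 'm, 'l, 'q) AI_tuple \<Rightarrow> nat \<Rightarrow> 'v set" where
  "pt_omega T X i \<equiv> omega T (pt_av X i)"

definition perp0 ::
  "('k::zero, 'a, 'm, 'l, 'q, 'v) av_deRham \<Rightarrow> ('a, 'm, 'l, 'q) AI_tuple \<Rightarrow> 'v set \<Rightarrow> 'v set" where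
  "perp0 T X S = {x \<in> pt_H1 T X 0. \<forall>y\<in>S. dR_pairing T (pt_av X 0) (pt_pol0 X) x y = 0}"

definition deRham_chain ::
  "('k, 'a, 'm, 'l, 'q, 'v) av_deRham \<Rightarrow> nat \<Rightarrow> ('a, 'm, 'l, 'q) AI_tuple \<Rightarrow> ('k, 'v) pol_chain" where
  "deRham_chain T g X =
     \<lparr> ch_smult = dR_smult T,
       ch_space = pt_H1 T X,
       ch_map = (\<lambda>i. alpha T X i (Suc i)),
       ch_form0 = dR_pairing T (pt_av X 0) (pt_pol0 X),
       ch_formg = dR_pairing T (pt_av X g) (pt_polg X) \<rparr>"

definition same_KR_stratum ::
  "('k::field, 'a, 'm, 'l, 'q, 'v::ab_group_add) av_deRham \<Rightarrow> nat \<Rightarrow> nat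
     \<Rightarrow> ('a, 'm, 'l, 'q) AI_tuple \<Rightarrow> ('a, 'm, 'l, 'q) AI_tuple \<Rightarrow> bool" where
  "same_KR_stratum T p g X X' \<longleftrightarrow>
     (\<exists>\<xi> \<in> chain_isos g (deRham_chain T g X) (lattice_chain p g).
      \<exists>\<xi>' \<in> chain_isos g (deRham_chain T g X') (lattice_chain p g).
        G_I_orbit p g (\<lambda>i. \<xi> i ` pt_omega T X i) = G_I_orbit p g (\<lambda>i. \<xi>' i ` pt_omega T X' i))"

text \<open>The facts about de Rham cohomology of abelian varieties on which the definition of the
  strata rests. Actual abelian varieties over \<open>k\<close> satisfy them; nothing is required of
  the components of the record which enter only through the definition of \<open>\<A>\<^sub>I\<close>.\<close>

locale av_deRham_theory =
  fixes T :: "('k::alg_closed_field, 'a, 'm, 'l, 'q, 'v::ab_group_add) av_deRham"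
    and p g N :: nat and \<zeta> :: 'k
  assumes ambient: "vector_space (dR_smult T)"
    and H1_subspace: "A \<in> AV T \<Longrightarrow> module.subspace (dR_smult T) (H1 T A)"
    and H1_dim: "A \<in> AV T \<Longrightarrow> vector_space.dim (dR_smult T) (H1 T A) = 2 * av_dim T A"
    and omega_subspace: "A \<in> AV T \<Longrightarrow> module.subspace (dR_smult T) (omega T A)"
    and omega_subset: "A \<in> AV T \<Longrightarrow> omega T A \<subseteq> H1 T A"
    and omega_dim: "A \<in> AV T \<Longrightarrow> vector_space.dim (dR_smult T) (omega T A) = av_dim T A"
    and pullback_linear:
      "\<lbrakk>A \<in> AV T; B \<in> AV T; f \<in> isogenies T A B\<rbrakk>
        \<Longrightarrow> linear_on (dR_smult T) (dR_smult T) (H1 T B) (dR_pullback T f)"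
    and pullback_H1:
      "\<lbrakk>A \<in> AV T; B \<in> AV T; f \<in> isogenies T A B\<rbrakk> \<Longrightarrow> dR_pullback T f ` H1 T B \<subseteq> H1 T A"
    and pullback_omega:
      "\<lbrakk>A \<in> AV T; B \<in> AV T; f \<in> isogenies T A B\<rbrakk> \<Longrightarrow> dR_pullback T f ` omega T B \<subseteq> omega T A"
    and omega_isotropic:
      "\<lbrakk>A \<in> AV T; l \<in> principal_pols T A; x \<in> omega T A; y \<in> omega T A\<rbrakk>
        \<Longrightarrow> dR_pairing T A l x y = 0"
    and lattice_chain_iso: \<comment> \<open>existence of the trivialisations \<open>\<xi>\<close>\<close>
      "X \<in> AI_points T p g N \<zeta> \<Longrightarrow> chain_isos g (deRham_chain T g X) (lattice_chain p g) \<noteq> {}"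

end

theory Submission
  imports Defs
begin

text \<open>A trivialisation \<open>\<xi>\<close> turns \<open>(A\<^sub>i)\<^sub>i\<close> into a chain of \<open>g\<close>-dimensional subspaces \<open>L\<^sub>i\<close> of the
standard chain \<open>\<Lambda>\<^bsub>-i\<^esub> \<otimes> k = k\<^bsup>2g\<^esup>\<close>, with \<open>L\<^sub>0\<close> and \<open>L\<^sub>g\<close> Lagrangian, and the numbers in the theorem
are invariants of the \<open>\<G>\<^sub>I(k)\<close>-orbit of \<open>(L\<^sub>i)\<^sub>i\<close>. In coordinates the map \<open>\<alpha>\<^bsub>ji\<^esub>\<close> just deletes the
coordinates \<open>2g-i+1, \<dots>, 2g-j\<close>. Two facts give the theorem.

Every orbit contains a chain of coordinate subspaces, \<open>L\<^sub>i = \<langle>e\<^sub>m | m \<in> S\<^sub>i\<rangle>\<close>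
(\<open>coordinate_normal_form\<close>). This is the Bruhat decomposition for the Iwahori subgroup of \<open>GSp\<close>, or
the statement that two chambers of the building lie in a common apartment, but it is proved here by
linear algebra over \<open>k\<close> alone. The half chain is completed to a chain indexed by \<open>\<int>/2g\<close> by putting
\<open>L\<^bsub>-i\<^esub> = L\<^sub>i\<^sup>\<bottom>\<close>. In this cyclic chain of vector spaces each \<open>e\<^sub>m\<close> is born at one index, survives
\<open>2g - 1\<close> steps and is then killed; its age at index \<open>i\<close> orders the coordinates of the \<open>i\<close>-th space.
Choose a vector \<open>v\<close> in some \<open>L\<^sub>j\<close> and a coordinate \<open>m\<close> with \<open>v\<^sub>m = 1\<close> such that the age of \<open>m\<close> at \<open>j\<close> is
the least possible. A unipotent automorphism of the self-dual chain maps \<open>v\<close> to \<open>e\<^sub>m\<close>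
(\<open>unipotent_normalizes\<close>). Afterwards \<open>e\<^sub>m\<close> lies in every \<open>L\<^sub>i\<close> in which some vector has a nonzero
\<open>m\<close>-th coordinate, and by duality the same holds for the dual coordinate \<open>2g+1-m\<close>. So the two
coordinate lines split off (\<open>split_step\<close>), and one continues with the remaining coordinates.
The form is alternating, which is used through the cancellation of pairs of terms in \<open>std_form_trunc\<close>,
so the characteristic may be \<open>2\<close>.

For coordinate chains the three families of numbers count the elements of \<open>S\<^sub>i\<close> in enough intervals to
decide, for every \<open>m\<close>, whether \<open>m \<in> S\<^sub>i\<close> (\<open>coordinate_chain_determined\<close>). So two points with equal
invariants can be trivialised such that their chains coincide.\<close>

section \<open>The standard alternating form on coordinate vectors\<close>

lemma vector_space_coord: "vector_space (coord_smult :: 'k::field \<Rightarrow> (nat \<Rightarrow> 'k) \<Rightarrow> _)"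
  by unfold_locales (auto simp: coord_smult_def fun_eq_iff algebra_simps)

interpretation cv: vector_space "coord_smult :: 'k::field \<Rightarrow> (nat \<Rightarrow> 'k) \<Rightarrow> _"
  by (rule vector_space_coord)

definition unit_vec :: "nat \<Rightarrow> nat \<Rightarrow> 'k::field" where
  "unit_vec m = (\<lambda>n. if n = m then 1 else 0)"

text \<open>With this sign the form reads \<open>\<Sum>\<^sub>m pol_sign g m * x\<^sub>m * y\<^bsub>2g+1-m\<^esub>\<close> over all of \<open>{1..2g}\<close>.\<close>

definition pol_sign :: "nat \<Rightarrow> nat \<Rightarrow> 'k::field" where
  "pol_sign g m = (if m \<le> g then 1 else - 1)"

lemma pol_sign_mult_self [simp]: "pol_sign g m * (pol_sign g m * x) = (x :: 'k::field)"
  "pol_sign g m * pol_sign g m = (1 :: 'k::field)"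
  by (auto simp: pol_sign_def)

lemma pol_sign_nz [simp]: "pol_sign g m \<noteq> (0 :: 'k::field)"
  by (auto simp: pol_sign_def)

lemma pol_sign_dual: "m \<in> {1..2*g} \<Longrightarrow> pol_sign g (2*g+1-m) = (- pol_sign g m :: 'k::field)"
  by (auto simp: pol_sign_def)

lemma std_form_sum:
  "std_form g x y = (\<Sum>m=1..2*g. pol_sign g m * x m * y (2*g+1-m) :: 'k::field)"
proof -
  have "{1..2*g} = {1..g} \<union> {g+1..2*g}" by auto
  hence "(\<Sum>m=1..2*g. pol_sign g m * x m * y (2*g+1-m))
      = (\<Sum>m=1..g. pol_sign g m * x m * y (2*g+1-m)) + (\<Sum>m=g+1..2*g. pol_sign g m * x m * y (2*g+1-m))"
    by (simp only:) (rule sum.union_disjoint, auto)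
  also have "(\<Sum>m=1..g. pol_sign g m * x m * y (2*g+1-m)) = (\<Sum>m=1..g. x m * y (2*g+1-m))"
    by (rule sum.cong) (auto simp: pol_sign_def)
  also have "(\<Sum>m=g+1..2*g. pol_sign g m * x m * y (2*g+1-m)) = (\<Sum>m=g+1..2*g. - (x m * y (2*g+1-m)))"
    by (rule sum.cong) (auto simp: pol_sign_def)
  finally show ?thesis by (simp add: std_form_def sum_negf)
qed

text \<open>Grouping the indices \<open>m\<close> and \<open>2g+1-m\<close> makes visible that the form is alternating, and not only
  skew-symmetric; this matters in characteristic \<open>2\<close>.\<close>

lemma std_form_pairs:
  "std_form g x y = (\<Sum>m=1..g. x m * y (2*g+1-m) - x (2*g+1-m) * y m :: 'k::field)"
proof -
  have "(\<Sum>i=g+1..2*g. x i * y (2*g + 1 - i)) = (\<Sum>m=1..g. x (2*g+1-m) * y m)"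
    by (rule sum.reindex_bij_witness[of _ "\<lambda>i. 2*g+1-i" "\<lambda>i. 2*g+1-i"]) auto
  thus ?thesis by (simp add: std_form_def sum_subtractf)
qed

lemma std_form_skew: "std_form g x y = (- std_form g y x :: 'k::field)"
  unfolding std_form_pairs sum_negf[symmetric] by (rule sum.cong) auto

lemma std_form_simps:
  "std_form g (x + x') y = std_form g x y + (std_form g x' y :: 'k::field)"
  "std_form g (x - x') y = std_form g x y - (std_form g x' y :: 'k::field)"
  "std_form g (coord_smult c x) y = c * (std_form g x y :: 'k::field)"
  "std_form g (0 :: nat \<Rightarrow> 'k) y = 0"
  "std_form g x (y + y') = std_form g x y + (std_form g x y' :: 'k::field)"
  "std_form g x (y - y') = std_form g x y - (std_form g x y' :: 'k::field)"
  "std_form g x (coord_smult c y) = c * (std_form g x y :: 'k::field)"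
  "std_form g x (0 :: nat \<Rightarrow> 'k) = 0"
  unfolding std_form_sum coord_smult_def
  by (auto simp: algebra_simps sum.distrib sum_subtractf sum_distrib_left intro!: sum.cong)

lemma std_form_unit_left:
  assumes "m \<in> {1..2*g}"
  shows "std_form g (unit_vec m) y = pol_sign g m * (y (2*g+1-m) :: 'k::field)"
proof -
  have "std_form g (unit_vec m) y = (\<Sum>n=1..2*g. if n = m then pol_sign g m * y (2*g+1-m) else 0)"
    unfolding std_form_sum by (rule sum.cong) (auto simp: unit_vec_def)
  thus ?thesis using assms by simp
qed

lemma std_form_unit_right:
  assumes "m \<in> {1..2*g}"
  shows "std_form g x (unit_vec m) = - (pol_sign g m * (x (2*g+1-m) :: 'k::field))"
  using std_form_skew[of g x "unit_vec m"] std_form_unit_left[OF assms, of x] by simp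

lemma subspace_coord_space: "cv.subspace (coord_space g)"
  by (auto simp: cv.subspace_def coord_space_def coord_smult_def)

lemma unit_vec_in_coord_space: "m \<in> {1..2*g} \<Longrightarrow> unit_vec m \<in> coord_space g"
  by (auto simp: unit_vec_def coord_space_def)

definition coord_span :: "nat set \<Rightarrow> (nat \<Rightarrow> 'k::field) set" where
  "coord_span S = {x. \<forall>n. n \<notin> S \<longrightarrow> x n = 0}"

lemma coord_space_eq_span: "coord_space g = coord_span {1..2*g}"
  by (simp add: coord_span_def coord_space_def)

lemma subspace_coord_span: "cv.subspace (coord_span S)"
  by (auto simp: cv.subspace_def coord_span_def coord_smult_def)

lemma sum_fun_apply: "(\<Sum>i\<in>A. f i) n = (\<Sum>i\<in>A. f i n)"
  by (induction A rule: infinite_finite_induct) auto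

lemma coord_expansion:
  assumes "finite S" "x \<in> coord_span S"
  shows "x = (\<Sum>m\<in>S. coord_smult (x m) (unit_vec m))"
proof
  fix n
  have "(\<Sum>m\<in>S. coord_smult (x m) (unit_vec m) n) = (\<Sum>m\<in>S. if m = n then x n else 0)"
    by (rule sum.cong) (auto simp: coord_smult_def unit_vec_def)
  thus "x n = (\<Sum>m\<in>S. coord_smult (x m) (unit_vec m)) n"
    using assms by (auto simp: sum_fun_apply coord_span_def)
qed

lemma inj_unit_vec: "inj (unit_vec :: nat \<Rightarrow> nat \<Rightarrow> 'k::field)"
  by (rule injI) (metis unit_vec_def zero_neq_one)

lemma independent_unit_vecs: "cv.independent ((unit_vec :: nat \<Rightarrow> nat \<Rightarrow> 'k::field) ` S)"
  unfolding cv.independent_explicit_module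
proof (intro allI impI)
  fix t and u :: "_ \<Rightarrow> 'k" and v :: "nat \<Rightarrow> 'k"
  assume t: "finite t" "t \<subseteq> unit_vec ` S" "(\<Sum>v\<in>t. coord_smult (u v) v) = 0" "v \<in> t"
  then obtain m where m: "v = unit_vec m" by auto
  have "0 = (\<Sum>w\<in>t. coord_smult (u w) w m)" using t(3) by (metis sum_fun_apply zero_fun_apply)
  also have "\<dots> = (\<Sum>w\<in>t. if w = v then u v else 0)"
  proof (rule sum.cong)
    fix w assume "w \<in> t"
    then obtain n where n: "w = unit_vec n" using t(2) by auto
    show "coord_smult (u w) w m = (if w = v then u v else 0)"
    proof (cases "n = m")
      case False
      hence "w \<noteq> v" using injD[OF inj_unit_vec] by (auto simp: n m)
      thus ?thesis using False by (auto simp: n coord_smult_def unit_vec_def)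
    qed (simp add: n m coord_smult_def unit_vec_def)
  qed simp
  also have "\<dots> = u v" using t by simp
  finally show "u v = 0" by simp
qed

lemma span_unit_vecs: "finite S \<Longrightarrow> cv.span ((unit_vec :: nat \<Rightarrow> nat \<Rightarrow> 'k::field) ` S) = coord_span S"
proof (rule cv.span_subspace)
  show "unit_vec ` S \<subseteq> (coord_span S :: (nat \<Rightarrow> 'k) set)" by (auto simp: coord_span_def unit_vec_def)
  show "finite S \<Longrightarrow> coord_span S \<subseteq> cv.span (unit_vec ` S :: (nat \<Rightarrow> 'k) set)"
  proof
    fix x :: "nat \<Rightarrow> 'k" assume "finite S" "x \<in> coord_span S"
    hence "x = (\<Sum>m\<in>S. coord_smult (x m) (unit_vec m))" by (rule coord_expansion)
    also have "\<dots> \<in> cv.span (unit_vec ` S)"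
      by (intro cv.span_sum cv.span_scale cv.span_base) auto
    finally show "x \<in> cv.span (unit_vec ` S)" .
  qed
qed (rule subspace_coord_span)

lemma dim_coord_span:
  assumes "finite S" shows "cv.dim (coord_span S :: (nat \<Rightarrow> 'k::field) set) = card S"
proof -
  have "cv.dim (coord_span S :: (nat \<Rightarrow> 'k) set) = card ((unit_vec :: nat \<Rightarrow> nat \<Rightarrow> 'k) ` S)"
    unfolding span_unit_vecs[OF assms, symmetric]
    by (rule cv.dim_span_eq_card_independent[OF independent_unit_vecs])
  also have "\<dots> = card S" by (rule card_image[OF inj_on_subset[OF inj_unit_vec]]) simp
  finally show ?thesis .
qed

section \<open>Orthogonal complements\<close>

definition std_perp :: "nat \<Rightarrow> (nat \<Rightarrow> 'k::field) set \<Rightarrow> (nat \<Rightarrow> 'k) set" where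
  "std_perp g S = {y \<in> coord_space g. \<forall>x\<in>S. std_form g x y = 0}"

lemma subspace_std_perp: "cv.subspace (std_perp g S)"
  using subspace_coord_space[of g, where ?'a='a]
  by (auto simp: cv.subspace_def std_perp_def std_form_simps)

lemma std_form_represents:
  assumes "Vector_Spaces.linear coord_smult (*) (f :: (nat \<Rightarrow> 'k::field) \<Rightarrow> 'k)"
  obtains y where "y \<in> coord_space g" "\<And>x. x \<in> coord_space g \<Longrightarrow> std_form g x y = f x"
proof
  interpret f: Vector_Spaces.linear coord_smult "(*)" f by fact
  define y where "y n = (if n \<in> {1..2*g} then pol_sign g (2*g+1-n) * f (unit_vec (2*g+1-n)) else 0)" for n
  show "y \<in> coord_space g" by (auto simp: coord_space_def y_def)
  fix x :: "nat \<Rightarrow> 'k" assume "x \<in> coord_space g"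
  hence "f x = f (\<Sum>m=1..2*g. coord_smult (x m) (unit_vec m))"
    using coord_expansion[of "{1..2*g}" x] by (simp add: coord_space_eq_span)
  also have "\<dots> = (\<Sum>m=1..2*g. x m * f (unit_vec m))" by (simp add: f.sum f.scale)
  also have "\<dots> = std_form g x y" unfolding std_form_sum
    by (intro sum.cong) (auto simp: y_def mult.left_commute)
  finally show "std_form g x y = f x" ..
qed

lemma vector_space_field: "vector_space ((*) :: 'k::field \<Rightarrow> 'k \<Rightarrow> 'k)"
  by unfold_locales (auto simp: algebra_simps)

text \<open>Dual bases with respect to the form. They replace a dimension count for orthogonal complements.\<close>

lemma ex_dual_vector:
  assumes "cv.independent B" "b \<in> B"
  shows "\<exists>y \<in> coord_space g. \<forall>x \<in> B \<inter> coord_space g. std_form g x y = (if x = b then 1 else (0 :: 'k::field))"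
proof -
  interpret p: vector_space_pair "coord_smult :: 'k \<Rightarrow> _" "(*) :: 'k \<Rightarrow> 'k \<Rightarrow> 'k"
    by (intro vector_space_pair.intro vector_space_coord vector_space_field)
  obtain f where f: "Vector_Spaces.linear coord_smult (*) f" "\<And>x. x \<in> B \<Longrightarrow> f x = (if x = b then 1 else (0::'k))"
    using p.linear_independent_extend[OF assms(1), of "\<lambda>x. if x = b then 1 else 0"] by auto
  obtain y where "y \<in> coord_space g" "\<And>x. x \<in> coord_space g \<Longrightarrow> std_form g x y = f x"
    using std_form_represents[OF f(1)] by blast
  thus ?thesis using f(2) by (intro bexI[of _ y]) auto
qed

lemma std_form_nondegenerate:
  assumes "y \<in> coord_space g" "\<And>x. x \<in> coord_space g \<Longrightarrow> std_form g x y = (0::'k::field)"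
  shows "y = 0"
proof
  fix n show "y n = 0 n"
  proof (cases "n \<in> {1..2*g}")
    case True
    hence "std_form g (unit_vec (2*g+1-n)) y = pol_sign g (2*g+1-n) * y n"
      by (subst std_form_unit_left) auto
    moreover have "std_form g (unit_vec (2*g+1-n)) y = 0"
      using True by (intro assms(2) unit_vec_in_coord_space) auto
    ultimately show ?thesis by simp
  qed (use assms(1) in \<open>auto simp: coord_space_def\<close>)
qed

text \<open>A vector outside \<open>L\<close>, together with a basis of \<open>L\<close>, belongs to an independent set; the dual vector
  is orthogonal to \<open>L\<close> but not to the given vector.\<close>

lemma std_perp_std_perp:
  assumes "cv.subspace L" "L \<subseteq> coord_space g"
  shows "std_perp g (std_perp g L) = (L :: (nat \<Rightarrow> 'k::field) set)"
proof
  show "L \<subseteq> std_perp g (std_perp g L)"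
  proof
    fix x assume x: "x \<in> L"
    have "std_form g y x = 0" if "y \<in> std_perp g L" for y
      using that x std_form_skew[of g y x] by (simp add: std_perp_def)
    thus "x \<in> std_perp g (std_perp g L)" using x assms(2) by (auto simp: std_perp_def)
  qed
  show "std_perp g (std_perp g L) \<subseteq> L"
  proof (rule ccontr)
    assume "\<not> std_perp g (std_perp g L) \<subseteq> L"
    then obtain z where z: "z \<in> std_perp g (std_perp g L)" "z \<notin> L" by auto
    obtain B where B: "B \<subseteq> L" "cv.independent B" "L \<subseteq> cv.span B"
      using cv.maximal_independent_subset by blast
    hence span: "cv.span B = L" using cv.span_subspace assms(1) by blast
    have ins: "cv.independent (insert z B)"
      using cv.independent_insertI[OF _ B(2)] z(2) span by auto
    obtain y where y: "y \<in> coord_space g"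
      "\<And>x. x \<in> insert z B \<inter> coord_space g \<Longrightarrow> std_form g x y = (if x = z then 1 else (0::'k))"
      using ex_dual_vector[OF ins, of z g] by auto
    have "std_form g x y = 0" if "x \<in> L" for x
    proof -
      from that have "x \<in> cv.span B" using span by simp
      thus ?thesis
      proof (induction rule: cv.span_induct)
        show "cv.subspace {a. std_form g a y = 0}" by (auto simp: cv.subspace_def std_form_simps)
        show "std_form g b y = 0" if "b \<in> B" for b using y(2)[of b] that B(1) assms(2) z(2) by (metis (no_types, lifting) Int_iff insertI2 subsetD)
      qed
    qed
    hence "y \<in> std_perp g L" using y(1) by (simp add: std_perp_def)
    hence "std_form g y z = 0" using z(1) by (simp add: std_perp_def)
    moreover have "std_form g z y = 1" using y(2)[of z] z(1) by (simp add: std_perp_def)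
    ultimately show False using std_form_skew[of g z y] by simp
  qed
qed

text \<open>Extend a basis \<open>B\<close> of \<open>L\<close> to a basis \<open>B'\<close> of the whole space. The vectors dual to \<open>B' - B\<close> span the
  complement of \<open>L\<close>. There are \<open>g\<close> of them, so there is no room for a vector of the complement outside \<open>L\<close>.\<close>

lemma lagrangian:
  assumes L: "cv.subspace L" "L \<subseteq> coord_space g" "cv.dim L = g"
    and iso: "\<And>x y. x \<in> L \<Longrightarrow> y \<in> L \<Longrightarrow> std_form g x y = 0"
  shows "std_perp g L = (L :: (nat \<Rightarrow> 'k::field) set)"
proof
  show "L \<subseteq> std_perp g L" using L(2) iso by (auto simp: std_perp_def)
  obtain B where B: "B \<subseteq> L" "cv.independent B" "L \<subseteq> cv.span B" "card B = g"
    using cv.basis_exists[of L] L(3) by blast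
  have span: "cv.span B = L" using B cv.span_subspace L(1) by blast
  obtain B' where B': "B \<subseteq> B'" "B' \<subseteq> coord_space g" "cv.independent B'" "coord_space g \<subseteq> cv.span B'"
    using cv.maximal_independent_subset_extend[OF subset_trans[OF B(1) L(2)] B(2)] .
  have "cv.span B' = coord_space g" using B' cv.span_subspace subspace_coord_space by blast
  hence cB': "card B' = 2 * g"
    using cv.dim_span_eq_card_independent[OF B'(3)] dim_coord_span[of "{1..2*g}", where ?'k='k]
    by (simp add: coord_space_eq_span)
  have finB': "finite B'"
  proof (rule conjunct1[OF cv.independent_span_bound])
    show "B' \<subseteq> cv.span (unit_vec ` {1..2*g})"
      using B'(2) by (simp only: span_unit_vecs finite_atLeastAtMost coord_space_eq_span)
  qed (use B'(3) in auto)
  have "\<exists>y. y \<in> coord_space g \<and> (\<forall>x\<in>B'. std_form g x y = (if x = b then 1 else (0::'k)))" if b: "b \<in> B'" for b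
    using ex_dual_vector[OF B'(3) b, of g] B'(2) by (auto simp: Int_absorb2)
  hence "\<exists>d. \<forall>b\<in>B'. d b \<in> coord_space g \<and> (\<forall>x\<in>B'. std_form g x (d b) = (if x = b then 1 else (0::'k)))"
    by (intro bchoice) blast
  then obtain d where d: "\<And>b. b \<in> B' \<Longrightarrow> d b \<in> coord_space g"
    "\<And>b x. b \<in> B' \<Longrightarrow> x \<in> B' \<Longrightarrow> std_form g x (d b) = (if x = b then 1 else (0::'k))"
    by blast
  have sub: "std_perp g L \<subseteq> cv.span (d ` (B' - B))"
  proof
    fix y assume y: "y \<in> std_perp g L"
    define y' where "y' = (\<Sum>b\<in>B'-B. coord_smult (std_form g b y) (d b))"
    have y': "y' \<in> cv.span (d ` (B' - B))" unfolding y'_def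
      by (intro cv.span_sum cv.span_scale cv.span_base) auto
    have y'c: "y' \<in> coord_space g" unfolding y'_def
      using d(1) by (intro cv.subspace_sum[OF subspace_coord_space] cv.subspace_scale[OF subspace_coord_space]) auto
    have lin: "Vector_Spaces.linear coord_smult (*) (std_form g (b :: nat \<Rightarrow> 'k))" for b
      unfolding Vector_Spaces.linear_iff by (auto simp: vector_space_coord vector_space_field std_form_simps)
    have orth: "std_form g b (y - y') = 0" if "b \<in> B'" for b
    proof -
      interpret f: Vector_Spaces.linear coord_smult "(*)" "std_form g b" by (rule lin)
      have "std_form g b y' = (\<Sum>c\<in>B'-B. std_form g c y * std_form g b (d c))"
        unfolding y'_def by (simp add: f.sum f.scale)
      also have "\<dots> = (\<Sum>c\<in>B'-B. if c = b then std_form g b y else 0)"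
        by (rule sum.cong) (use d(2) that in auto)
      also have "\<dots> = std_form g b y"
        using finB' that y B(1) by (auto simp: std_perp_def)
      finally show ?thesis by (simp add: std_form_simps)
    qed
    have "y - y' = 0"
    proof (rule std_form_nondegenerate)
      show "y - y' \<in> coord_space g"
        using y y'c by (intro cv.subspace_diff[OF subspace_coord_space]) (auto simp: std_perp_def)
      fix x :: "nat \<Rightarrow> 'k" assume "x \<in> coord_space g"
      hence "x \<in> cv.span B'" using B'(4) by blast
      thus "std_form g x (y - y') = 0"
      proof (induction rule: cv.span_induct)
        show "cv.subspace {a. std_form g a (y - y') = 0}" by (auto simp: cv.subspace_def std_form_simps)
      qed (rule orth)
    qed
    thus "y \<in> cv.span (d ` (B' - B))" using y' by simp
  qed
  show "std_perp g L \<subseteq> L"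
  proof (rule ccontr)
    assume "\<not> std_perp g L \<subseteq> L"
    then obtain z where z: "z \<in> std_perp g L" "z \<notin> L" by auto
    have "card (insert z B) \<le> card (d ` (B' - B))"
    proof (rule conjunct2[OF cv.independent_span_bound])
      show "finite (d ` (B' - B))" using finB' by simp
      show "cv.independent (insert z B)" using cv.independent_insertI[OF _ B(2)] z(2) span by auto
      show "insert z B \<subseteq> cv.span (d ` (B' - B))"
        using z B(1) \<open>L \<subseteq> std_perp g L\<close> sub by auto
    qed
    also have "\<dots> \<le> card (B' - B)" using finB' by (intro card_image_le) auto
    also have "\<dots> = g" using B'(1) finB' cB' B(4) by (simp add: card_Diff_subset finite_subset)
    finally show False using B(4) z(2) B(1) finB' B'(1) by (subst (asm) card_insert_disjoint) (auto intro: finite_subset)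
  qed
qed

section \<open>The cyclic chain of coordinate spaces\<close>

text \<open>The space at index \<open>i\<close> is \<open>\<Lambda>\<^bsub>-i\<^esub> \<otimes> k\<close>, for all integers \<open>i\<close>, with the basis \<open>e\<^sub>1, \<dots>, e\<^bsub>2g\<^esub>\<close> obtained by
  rescaling; it depends only on \<open>i\<close> modulo \<open>2g\<close>, and the standard form pairs the spaces at \<open>i\<close> and \<open>-i\<close>.
  The vector \<open>e\<^sub>m\<close> is not in the image from index \<open>i + 1\<close> exactly if \<open>m + i\<close> is divisible by \<open>2g\<close>, and then
  its age is \<open>0\<close>. Each step from \<open>i + 1\<close> to \<open>i\<close> raises the age by one, until the vector of age \<open>2g - 1\<close>
  is mapped to zero.\<close>

definition age :: "nat \<Rightarrow> int \<Rightarrow> nat \<Rightarrow> int" where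
  "age g i m = (- int m - i) mod (2 * int g)"

definition chain_step :: "nat \<Rightarrow> int \<Rightarrow> (nat \<Rightarrow> 'k::field) \<Rightarrow> (nat \<Rightarrow> 'k)" where
  "chain_step g i x = (\<lambda>n. if 2 * int g dvd int n + i then 0 else x n)"

lemma age_bounds:
  assumes "g \<ge> 1" shows "0 \<le> age g i m" "age g i m < 2 * int g"
  using assms by (auto simp: age_def)

lemma age_cong: "2 * int g dvd i - j \<Longrightarrow> age g i m = age g j m"
  unfolding age_def by (subst mod_eq_dvd_iff) (simp add: dvd_diff_commute)

lemma age_eq_imp_dvd: "age g i m = age g j m \<Longrightarrow> 2 * int g dvd i - j"
  unfolding age_def mod_eq_dvd_iff by (simp add: dvd_diff_commute)

lemma age_dies:
  assumes "g \<ge> 1" "2 * int g dvd int m + i"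
  shows "age g i m = 0" "age g (i + 1) m = 2 * int g - 1"
proof -
  from assms(2) obtain k where k: "int m + i = 2 * int g * k" by (auto simp: dvd_def)
  have "- int m - i = 0 + (- k) * (2 * int g)" using k by (simp add: algebra_simps)
  thus "age g i m = 0" by (simp only: age_def mod_mult_self1 mod_0)
  have "- int m - (i + 1) = (2 * int g - 1) + (- k - 1) * (2 * int g)" using k by (simp add: algebra_simps)
  hence "age g (i + 1) m = (2 * int g - 1) mod (2 * int g)" by (simp only: age_def mod_mult_self1)
  also have "\<dots> = 2 * int g - 1" using assms(1) by (intro mod_pos_pos_trivial) auto
  finally show "age g (i + 1) m = 2 * int g - 1" .
qed

lemma age_survives:
  assumes "g \<ge> 1" "\<not> 2 * int g dvd int m + i"
  shows "age g i m = age g (i + 1) m + 1"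
proof -
  define a where "a = - int m - (i + 1)"
  have "age g i m = (a + 1) mod (2 * int g)" by (simp add: age_def a_def)
  also have "\<dots> = (a mod (2 * int g) + 1) mod (2 * int g)" by (simp add: mod_add_left_eq)
  finally have *: "age g i m = (age g (i + 1) m + 1) mod (2 * int g)" by (simp add: age_def a_def)
  have "age g (i + 1) m + 1 \<noteq> 2 * int g"
  proof
    assume "age g (i + 1) m + 1 = 2 * int g"
    with * have "age g i m = 0" by simp
    hence "2 * int g dvd - int m - i" by (simp add: age_def dvd_eq_mod_eq_0)
    hence "2 * int g dvd - (- int m - i)" by (simp only: dvd_minus_iff)
    thus False using assms(2) by (simp add: algebra_simps)
  qed
  thus ?thesis using * age_bounds[OF assms(1), of "i + 1" m] by simp
qed

lemma dying_unique:
  assumes "m \<in> {1..2*g}" "n \<in> {1..2*g}" "2 * int g dvd int m + i" "2 * int g dvd int n + i"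
  shows "m = n"
proof -
  have "2 * int g dvd (int m + i) - (int n + i)" using assms(3,4) by (rule dvd_diff)
  hence "2 * int g dvd \<bar>int m - int n\<bar>" by simp
  moreover have "\<bar>int m - int n\<bar> < 2 * int g" using assms by auto
  ultimately show ?thesis using zdvd_imp_le by fastforce
qed

text \<open>Since \<open>e\<^sub>m\<close> at \<open>i\<close> and \<open>e\<^bsub>2g+1-m\<^esub>\<close> at \<open>-i\<close> are paired, one is young when the other is old.\<close>

lemma age_dual:
  assumes "g \<ge> 1" "m \<in> {1..2*g}"
  shows "age g (- i) (2*g+1-m) = 2 * int g - 1 - age g i m"
proof -
  define M a where "M = 2 * int g" and "a = - int m - i"
  have "int (2*g+1-m) = 2 * int g + 1 - int m" using assms(2) by auto
  hence "age g (- i) (2*g+1-m) = (- 1 - a + (- 1) * M) mod M"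
    unfolding age_def M_def a_def by (intro arg_cong2[where f = "(mod)"]) auto
  also have "\<dots> = (- 1 - a) mod M" by (rule mod_mult_self1)
  also have "\<dots> = (M - 1 - a) mod M"
    using mod_add_self2[of "- 1 - a" M] by (simp add: algebra_simps)
  also have "\<dots> = (M - 1 - a mod M) mod M" by (simp add: mod_diff_right_eq)
  also have "\<dots> = M - 1 - a mod M"
    using assms(1) pos_mod_bound[of M a] pos_mod_sign[of M a] by (intro mod_pos_pos_trivial) (auto simp: M_def simp del: pos_mod_sign pos_mod_bound)
  finally show ?thesis by (simp add: M_def a_def age_def)
qed

text \<open>The ages of \<open>m\<close> and its dual have the same sum as those of \<open>n\<close> and its dual, modulo \<open>2g\<close>. Hence
  \<open>n \<mapsto> 2g+1-n\<close> reverses the interval of the coordinates whose age lies between those of \<open>m\<close> and \<open>2g+1-m\<close>.\<close>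

lemma age_between_dual:
  assumes g: "g \<ge> 1" and mn: "m \<in> {1..2*g}" "n \<in> {1..2*g}"
    and b: "age g i m \<le> age g i n" "age g i n \<le> age g i (2*g+1-m)"
  shows "age g i m \<le> age g i (2*g+1-n) \<and> age g i (2*g+1-n) \<le> age g i (2*g+1-m)"
proof -
  define M where "M = 2 * int g"
  have i: "int (2*g+1-n) = M + 1 - int n" "int (2*g+1-m) = M + 1 - int m" using mn by (auto simp: M_def)
  have "age g i (2*g+1-n) = (- int (2*g+1-n) - i) mod M" by (simp add: age_def M_def)
  also have "- int (2*g+1-n) - i = (- int m - i) + (- int (2*g+1-m) - i) - (- int n - i)" using i by linarith
  also have "\<dots> mod M = (age g i m + age g i (2*g+1-m) - age g i n) mod M"
    unfolding age_def M_def[symmetric] by (intro mod_diff_cong mod_add_cong) simp_all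
  also have "\<dots> = age g i m + age g i (2*g+1-m) - age g i n"
    using b age_bounds[OF g, of i m] age_bounds[OF g, of i "2*g+1-m"]
    by (intro mod_pos_pos_trivial) (auto simp: M_def)
  finally show ?thesis using b by simp
qed

lemma chain_step_in_coord_space: "x \<in> coord_space g \<Longrightarrow> chain_step g i x \<in> coord_space g"
  by (auto simp: chain_step_def coord_space_def)

lemma chain_step_simps:
  "chain_step g i (x + y) = chain_step g i x + chain_step g i y"
  "chain_step g i (x - y) = chain_step g i x - chain_step g i y"
  "chain_step g i (coord_smult c x) = coord_smult c (chain_step g i x)"
  "chain_step g i 0 = 0"
  by (auto simp: chain_step_def coord_smult_def fun_eq_iff)

lemma chain_step_cong: "2 * int g dvd i - j \<Longrightarrow> chain_step g i = chain_step g j"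
proof -
  assume d: "2 * int g dvd i - j"
  have "2 * int g dvd int n + i \<longleftrightarrow> 2 * int g dvd int n + j" for n
    using dvd_add_left_iff[OF d, of "int n + j"] by (simp add: algebra_simps)
  thus ?thesis by (simp add: chain_step_def fun_eq_iff)
qed

lemma dies_dual:
  assumes "n \<in> {1..2*g}"
  shows "2 * int g dvd int (2*g+1-n) + i \<longleftrightarrow> 2 * int g dvd int n + (- i - 1)"
proof -
  have "int (2*g+1-n) + i = 2 * int g + - (int n + (- i - 1))" using assms by auto
  thus ?thesis by (simp only: dvd_add_right_iff[OF dvd_refl] dvd_minus_iff)
qed

lemma chain_step_adjoint: "std_form g y (chain_step g i x) = std_form g (chain_step g (- i - 1) y) (x :: nat \<Rightarrow> 'k::field)"
  unfolding std_form_sum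
proof (rule sum.cong)
  fix n assume "n \<in> {1..2*g}"
  from dies_dual[OF this, of i]
  show "pol_sign g n * y n * chain_step g i x (2*g+1-n) = pol_sign g n * chain_step g (- i - 1) y n * x (2*g+1-n)"
    by (simp add: chain_step_def)
qed simp

text \<open>Read \<open>v\<close> as a vector of the space in which \<open>e\<^sub>m\<close> is born, where every other coordinate is older than \<open>m\<close>.
  This is its image at index \<open>i\<close>: a coordinate that is younger than \<open>m\<close> at \<open>i\<close> has been killed, and born
  again, on the way.\<close>

definition trunc :: "nat \<Rightarrow> nat \<Rightarrow> int \<Rightarrow> (nat \<Rightarrow> 'k::field) \<Rightarrow> (nat \<Rightarrow> 'k)" where
  "trunc g m i v = (\<lambda>n. if age g i m \<le> age g i n then v n else 0)"

lemma trunc_in_coord_space: "v \<in> coord_space g \<Longrightarrow> trunc g m i v \<in> coord_space g"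
  by (auto simp: trunc_def coord_space_def)

text \<open>In the step in which \<open>e\<^sub>m\<close> dies all other coordinates have been truncated before, so the image is zero,
  while at the next index, where \<open>e\<^sub>m\<close> is born again, the truncation is all of \<open>v\<close>. Hence the case distinction.\<close>

lemma chain_step_trunc:
  assumes g: "g \<ge> 1" and m: "m \<in> {1..2*g}" and v: "v \<in> coord_space g" "v m = 0"
  shows "chain_step g i (trunc g m (i + 1) v) = (if 2 * int g dvd int m + i then 0 else trunc g m i v)"
proof
  fix n
  show "chain_step g i (trunc g m (i + 1) v) n = (if 2 * int g dvd int m + i then 0 else trunc g m i v) n"
  proof (cases "n \<in> {1..2*g}")
    case True
    show ?thesis
    proof (cases "2 * int g dvd int m + i")
      case m_dies: True
      show ?thesis
      proof (cases "2 * int g dvd int n + i")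
        case False
        thus ?thesis using m_dies age_dies[OF g m_dies] age_survives[OF g False] age_bounds[OF g, of i n]
          by (auto simp: chain_step_def trunc_def)
      qed (simp add: chain_step_def m_dies)
    next
      case m_lives: False
      show ?thesis
      proof (cases "2 * int g dvd int n + i")
        case False
        thus ?thesis using m_lives age_survives[OF g m_lives] age_survives[OF g False]
          by (auto simp: chain_step_def trunc_def)
      next
        case True
        thus ?thesis using m_lives age_survives[OF g m_lives] age_dies[OF g True] age_bounds[OF g, of "i+1" m]
          by (auto simp: chain_step_def trunc_def)
      qed
    qed
  next
    case False
    thus ?thesis using v(1) by (auto simp: chain_step_def trunc_def coord_space_def)
  qed
qed

text \<open>The terms of the form that survive the truncation are those whose index lies in an interval stable under
  \<open>n \<mapsto> 2g+1-n\<close>, so they cancel in pairs. Over the Laurent series this says \<open>\<psi>(v, v) = 0\<close>.\<close>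

lemma std_form_trunc:
  fixes v :: "nat \<Rightarrow> 'k::field"
  assumes g: "g \<ge> 1" and m: "m \<in> {1..2*g}"
  shows "std_form g (trunc g m (- i) v) (trunc g m i v) = 0"
  unfolding std_form_pairs
proof (rule sum.neutral, intro ballI)
  fix n assume n: "n \<in> {1..g}"
  let ?n = "2*g+1-n" and ?m = "2*g+1-m"
  have mem: "n \<in> {1..2*g}" "?n \<in> {1..2*g}" "?m \<in> {1..2*g}" "2*g+1-?n = n" "2*g+1-?m = m" using n m by auto
  have 1: "age g (-i) m \<le> age g (-i) n \<longleftrightarrow> age g i ?n \<le> age g i ?m"
    using age_dual[OF g mem(2), of i] age_dual[OF g mem(3), of i] mem by simp
  have 2: "age g (-i) m \<le> age g (-i) ?n \<longleftrightarrow> age g i n \<le> age g i ?m"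
    using age_dual[OF g mem(1), of i] age_dual[OF g mem(3), of i] mem by simp
  show "trunc g m (- i) v n * trunc g m i v ?n - trunc g m (- i) v ?n * trunc g m i v n = 0"
    using age_between_dual[OF g m mem(1), of i] age_between_dual[OF g m mem(2), of i]
    unfolding trunc_def 1 2 mem(4) by auto
qed

section \<open>Self-dual chains and their automorphisms\<close>

definition chain_aut :: "nat \<Rightarrow> (int \<Rightarrow> (nat \<Rightarrow> 'k::field) \<Rightarrow> (nat \<Rightarrow> 'k)) \<Rightarrow> bool" where
  "chain_aut g \<gamma> \<longleftrightarrow>
     (\<forall>i. linear_on coord_smult coord_smult (coord_space g) (\<gamma> i) \<and>
          bij_betw (\<gamma> i) (coord_space g) (coord_space g)) \<and>
     (\<forall>i. \<forall>x\<in>coord_space g. chain_step g i (\<gamma> (i + 1) x) = \<gamma> i (chain_step g i x)) \<and>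
     (\<forall>i. \<forall>x\<in>coord_space g. \<forall>y\<in>coord_space g. std_form g (\<gamma> i x) (\<gamma> (- i) y) = std_form g x y) \<and>
     (\<forall>i j. 2 * int g dvd i - j \<longrightarrow> \<gamma> i = \<gamma> j)"

lemma chain_autD:
  assumes "chain_aut g \<gamma>"
  shows "linear_on coord_smult coord_smult (coord_space g) (\<gamma> i)"
    and "bij_betw (\<gamma> i) (coord_space g) (coord_space g)"
    and "x \<in> coord_space g \<Longrightarrow> chain_step g i (\<gamma> (i + 1) x) = \<gamma> i (chain_step g i x)"
    and "x \<in> coord_space g \<Longrightarrow> y \<in> coord_space g \<Longrightarrow> std_form g (\<gamma> i x) (\<gamma> (- i) y) = std_form g x y"
    and "2 * int g dvd i - j \<Longrightarrow> \<gamma> i = \<gamma> j"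
  using assms unfolding chain_aut_def by (simp_all only:)

lemma chain_aut_id: "chain_aut g (\<lambda>i x. x)"
  by (auto simp: chain_aut_def linear_on_def bij_betw_def)

lemma chain_aut_comp:
  assumes "chain_aut g \<gamma>" "chain_aut g \<delta>"
  shows "chain_aut g (\<lambda>i x. \<delta> i (\<gamma> i x))"
proof -
  have maps: "\<gamma> i x \<in> coord_space g" if "x \<in> coord_space g" for i x
    using assms(1) that by (auto simp: chain_aut_def bij_betw_def)
  have "bij_betw (\<lambda>x. \<delta> i (\<gamma> i x)) (coord_space g) (coord_space g)" for i
    using bij_betw_trans[of "\<gamma> i" "coord_space g" "coord_space g" "\<delta> i"] assms
    by (auto simp: chain_aut_def comp_def)
  thus ?thesis using assms maps chain_step_in_coord_space
    by (simp add: chain_aut_def linear_on_def)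
qed

text \<open>Such a family is the same as a self-dual periodic chain of lattices \<open>\<L>\<^sub>i\<close> in the Laurent series with
  \<open>t\<Lambda>\<^bsub>-i\<^esub> \<subseteq> \<L>\<^sub>i \<subseteq> \<Lambda>\<^bsub>-i\<^esub>\<close>.\<close>

definition self_dual_chain :: "nat \<Rightarrow> (int \<Rightarrow> (nat \<Rightarrow> 'k::field) set) \<Rightarrow> bool" where
  "self_dual_chain g L \<longleftrightarrow>
     (\<forall>i. cv.subspace (L i) \<and> L i \<subseteq> coord_space g) \<and>
     (\<forall>i. chain_step g i ` L (i + 1) \<subseteq> L i) \<and>
     (\<forall>i. L (- i) = std_perp g (L i)) \<and>
     (\<forall>i j. 2 * int g dvd i - j \<longrightarrow> L i = L j)"

lemma self_dual_chainD:
  assumes "self_dual_chain g L"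
  shows "cv.subspace (L i)" and "L i \<subseteq> coord_space g"
    and "x \<in> L (i + 1) \<Longrightarrow> chain_step g i x \<in> L i"
    and "L (- i) = std_perp g (L i)"
    and "2 * int g dvd i - j \<Longrightarrow> L i = L j"
  using assms unfolding self_dual_chain_def by (simp_all only:) blast

lemma linear_on_image_subspace:
  assumes "vector_space s" "vector_space t"
    and f: "linear_on s t V f" and L: "module.subspace s L" "L \<subseteq> V"
  shows "module.subspace t (f ` L)"
proof -
  interpret s: vector_space s by fact
  interpret t: vector_space t by fact
  have add: "f (x + y) = f x + f y" if "x \<in> L" "y \<in> L" for x y
    using f L(2) that unfolding linear_on_def by blast
  have scale: "f (s c x) = t c (f x)" if "x \<in> L" for x c
    using f L(2) that unfolding linear_on_def by blast
  have 0: "0 \<in> L" by (rule s.subspace_0[OF L(1)])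
  show ?thesis
  proof (rule t.subspaceI)
    have "f 0 = 0" using scale[OF 0, of 0] by simp
    thus "0 \<in> f ` L" using 0 by (metis image_eqI)
  next
    fix x y assume "x \<in> f ` L" "y \<in> f ` L"
    then obtain v w where "x = f v" "y = f w" "v \<in> L" "w \<in> L" by blast
    thus "x + y \<in> f ` L" using add[of v w] s.subspace_add[OF L(1), of v w] by (metis image_eqI)
  next
    fix c x assume "x \<in> f ` L"
    then obtain v where "x = f v" "v \<in> L" by blast
    thus "t c x \<in> f ` L" using scale[of v c] s.subspace_scale[OF L(1), of v c] by (metis image_eqI)
  qed
qed

lemma self_dual_chain_image:
  assumes \<gamma>: "chain_aut g \<gamma>" and L: "self_dual_chain g L"
  shows "self_dual_chain g (\<lambda>i. \<gamma> i ` L i)"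
proof -
  have bij: "bij_betw (\<gamma> i) (coord_space g) (coord_space g)" for i using \<gamma> by (simp add: chain_aut_def)
  have sub: "L i \<subseteq> coord_space g" for i using L by (simp add: self_dual_chain_def)
  have form: "std_form g (\<gamma> i x) (\<gamma> (- i) y) = std_form g x y"
    if "x \<in> coord_space g" "y \<in> coord_space g" for i x y using \<gamma> that by (simp add: chain_aut_def)
  have 1: "cv.subspace (\<gamma> i ` L i)" for i
    using \<gamma> L by (intro linear_on_image_subspace[OF vector_space_coord vector_space_coord chain_autD(1)] self_dual_chainD)
  have 2: "\<gamma> i ` L i \<subseteq> coord_space g" for i
    using bij_betw_imp_surj_on[OF bij] sub by blast
  have 3: "chain_step g i ` \<gamma> (i + 1) ` L (i + 1) \<subseteq> \<gamma> i ` L i" for i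
  proof clarify
    fix x assume x: "x \<in> L (i + 1)"
    hence "chain_step g i (\<gamma> (i + 1) x) = \<gamma> i (chain_step g i x)"
      using \<gamma> subsetD[OF sub] unfolding chain_aut_def by blast
    moreover have "chain_step g i x \<in> L i" using L x unfolding self_dual_chain_def by blast
    ultimately show "chain_step g i (\<gamma> (i + 1) x) \<in> \<gamma> i ` L i" by simp
  qed
  have 4: "\<gamma> (- i) ` L (- i) = std_perp g (\<gamma> i ` L i)" for i
  proof -
    have Li: "L (- i) = std_perp g (L i)" using L by (simp add: self_dual_chain_def)
    have "\<gamma> (- i) y \<in> std_perp g (\<gamma> i ` L i) \<longleftrightarrow> y \<in> L (- i)" if "y \<in> coord_space g" for y
      unfolding Li using that sub bij_betwE[OF bij] form by (auto simp: std_perp_def subset_iff)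
    moreover have "std_perp g (\<gamma> i ` L i) \<subseteq> \<gamma> (- i) ` coord_space g"
      using bij_betw_imp_surj_on[OF bij, of "- i"] by (auto simp: std_perp_def)
    ultimately show ?thesis using sub[of "- i"] by blast
  qed
  have 5: "\<gamma> i ` L i = \<gamma> j ` L j" if "2 * int g dvd i - j" for i j
  proof -
    have "\<gamma> i = \<gamma> j" "L i = L j" using chain_autD(5)[OF \<gamma> that] self_dual_chainD(5)[OF L that] .
    thus ?thesis by simp
  qed
  show ?thesis unfolding self_dual_chain_def by (intro conjI allI impI) (rule 1 2 3 4 5, assumption?)+
qed

section \<open>Unipotent automorphisms\<close>

text \<open>Up to truncation this is the symplectic map that sends \<open>e\<^sub>m + v'\<close> to \<open>e\<^sub>m\<close> and fixes \<open>e\<^bsub>2g+1-m\<^esub>\<close>, where \<open>v'\<close> is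
  \<open>v\<close> without its \<open>m\<close>-th coordinate. The second summand removes the coordinates other than \<open>m\<close> and
  \<open>2g+1-m\<close>. The last one is forced by the form: the coordinate at \<open>2g+1-m\<close> of the image of \<open>x\<close> must be, up
  to sign, the pairing of \<open>x\<close> with the vector that is mapped to \<open>e\<^sub>m\<close>.\<close>

definition unipotent :: "nat \<Rightarrow> nat \<Rightarrow> (nat \<Rightarrow> 'k::field) \<Rightarrow> int \<Rightarrow> (nat \<Rightarrow> 'k) \<Rightarrow> (nat \<Rightarrow> 'k)" where
  "unipotent g m v i x =
     x - coord_smult (x m) (trunc g m i (v(m := 0, 2*g+1-m := 0)))
       + coord_smult (pol_sign g m * std_form g (trunc g m (- i) (v(m := 0))) x) (unit_vec (2*g+1-m))"

lemma dual_index: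
  "m \<in> {1..2*g} \<Longrightarrow> 2*g+1-m \<in> {1..2*g}"
  "m \<in> {1..2*g} \<Longrightarrow> 2*g+1-(2*g+1-m) = m"
  "m \<in> {1..2*g} \<Longrightarrow> 2*g+1-m \<noteq> (m::nat)"
  by auto presburger

lemma std_form_apply_right_dual:
  assumes "m \<in> {1..2*g}"
  shows "std_form g x (unit_vec (2*g+1-m)) = pol_sign g m * (x m :: 'k::field)"
  unfolding std_form_unit_right[OF dual_index(1)[OF assms]] pol_sign_dual[OF assms] dual_index(2)[OF assms]
  by simp

lemma std_form_apply_left_dual:
  assumes "m \<in> {1..2*g}"
  shows "std_form g (unit_vec (2*g+1-m)) x = - (pol_sign g m * (x m :: 'k::field))"
  using std_form_apply_right_dual[OF assms] std_form_skew[of g "unit_vec (2*g+1-m)" x] by simp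

lemma trunc_upd_dual:
  fixes v :: "nat \<Rightarrow> 'k::field"
  assumes "m \<in> {1..2*g}"
  shows "trunc g m i (v(m := 0)) = trunc g m i (v(m := 0, 2*g+1-m := 0))
     + coord_smult (trunc g m i v (2*g+1-m)) (unit_vec (2*g+1-m))"
  using dual_index(3)[OF assms] by (auto simp: fun_eq_iff trunc_def coord_smult_def unit_vec_def)

lemma trunc_uminus: "trunc g m i (- v) = - trunc g m i v"
  by (simp add: trunc_def fun_eq_iff)

lemma unipotent_at:
  assumes "m \<in> {1..2*g}"
  shows "unipotent g m v i x m = x m"
  using dual_index(3)[OF assms] by (simp add: unipotent_def coord_smult_def trunc_def unit_vec_def)

lemma unipotent_other:
  assumes "n \<noteq> m" "n \<noteq> 2*g+1-m"
  shows "unipotent g m v i x n = x n - x m * trunc g m i v n"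
  using assms by (simp add: unipotent_def coord_smult_def trunc_def unit_vec_def)

text \<open>The \<open>(2g+1-m)\<close>-th coordinate pairs only with the \<open>m\<close>-th one, which is absent on the right.\<close>

lemma std_form_trunc_dual:
  fixes v :: "nat \<Rightarrow> 'k::field"
  assumes "g \<ge> 1" and m: "m \<in> {1..2*g}"
  shows "std_form g (trunc g m (- i) (v(m := 0))) (trunc g m i (w(m := 0, 2*g+1-m := 0)))
       = std_form g (trunc g m (- i) (v(m := 0, 2*g+1-m := 0))) (trunc g m i (w(m := 0, 2*g+1-m := 0)))"
proof -
  have "trunc g m i (w(m := 0, 2*g+1-m := 0)) m = 0" by (simp add: trunc_def)
  thus ?thesis unfolding trunc_upd_dual[OF m] std_form_simps std_form_apply_left_dual[OF m] by simp
qed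

lemma unipotent_in_coord_space:
  assumes "m \<in> {1..2*g}" "v \<in> coord_space g" "x \<in> coord_space g"
  shows "unipotent g m v i x \<in> coord_space g"
proof -
  have "v(m := 0, 2*g+1-m := 0) \<in> coord_space g" using assms(2) by (auto simp: coord_space_def)
  thus ?thesis unfolding unipotent_def
    using assms(3) unit_vec_in_coord_space[OF dual_index(1)[OF assms(1)]]
    by (intro cv.subspace_add[OF subspace_coord_space] cv.subspace_diff[OF subspace_coord_space]
        cv.subspace_scale[OF subspace_coord_space] trunc_in_coord_space)
qed

text \<open>Both correction terms are computed from quantities that the map leaves unchanged: the \<open>m\<close>-th coordinate
  and the pairing with the truncation of \<open>v\<close>. The latter is unchanged because the truncations are isotropic.\<close>

lemma unipotent_inverse:
  fixes v :: "nat \<Rightarrow> 'k::field"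
  assumes g: "g \<ge> 1" and m: "m \<in> {1..2*g}"
  shows "unipotent g m (- v) i (unipotent g m v i x) = x"
proof -
  let ?h = "trunc g m i (v(m := 0, 2*g+1-m := 0))" and ?t = "trunc g m (- i) (v(m := 0))"
  let ?e = "unit_vec (2*g+1-m) :: nat \<Rightarrow> 'k"
  have neg: "(- w)(k := 0) = - w(k := 0)" for w :: "nat \<Rightarrow> 'k" and k by (auto simp: fun_eq_iff)
  have h: "std_form g ?t ?h = 0"
    unfolding std_form_trunc_dual[OF g m] by (rule std_form_trunc[OF g m])
  have e: "std_form g ?t ?e = 0" unfolding std_form_apply_right_dual[OF m] by (simp add: trunc_def)
  have fm: "std_form g (- y) z = - std_form g y z" for y z :: "nat \<Rightarrow> 'k"
    using std_form_simps(2)[of g 0 y z] std_form_simps(4)[of g z] by simp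
  have sf: "std_form g ?t (unipotent g m v i x) = std_form g ?t x"
    unfolding unipotent_def std_form_simps h e by simp
  have "unipotent g m (- v) i (unipotent g m v i x)
      = unipotent g m v i x + coord_smult (x m) ?h - coord_smult (pol_sign g m * std_form g ?t x) ?e"
    unfolding unipotent_def[of g m "- v"] neg trunc_uminus fm sf unipotent_at[OF m]
    by (simp add: fun_eq_iff coord_smult_def)
  thus ?thesis by (simp add: unipotent_def)
qed

text \<open>In the expansion the mixed terms cancel by the choice of the last summand in the definition. What remains
  is the pairing of two truncations, which vanishes, and the contribution of the coordinate \<open>2g+1-m\<close> of \<open>v\<close>,
  which occurs twice with opposite signs since the condition on its age is the same at \<open>i\<close> and \<open>-i\<close>.\<close>

lemma unipotent_form:
  fixes v :: "nat \<Rightarrow> 'k::field"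
  assumes g: "g \<ge> 1" and m: "m \<in> {1..2*g}"
  shows "std_form g (unipotent g m v i x) (unipotent g m v (- i) y) = std_form g x y"
proof -
  let ?s = "pol_sign g m :: 'k" and ?e = "unit_vec (2*g+1-m) :: nat \<Rightarrow> 'k"
  let ?h = "\<lambda>i. trunc g m i (v(m := 0, 2*g+1-m := 0))"
  have mem: "2*g+1-m \<in> {1..2*g}" "2*g+1-(2*g+1-m) = m" using m by auto
  have hm: "?h i m = 0" "?e m = 0" for i using dual_index(3)[OF m] by (simp_all add: trunc_def unit_vec_def)
  have ee: "std_form g ?e ?e = 0" unfolding std_form_apply_right_dual[OF m]
    using dual_index(3)[OF m] by (simp add: unit_vec_def)
  have hh: "std_form g (?h i) (?h (- i)) = 0"
    using std_form_trunc[OF g m, of "- i" "v(m := 0, 2*g+1-m := 0)"] by simp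
  have sym: "trunc g m i v (2*g+1-m) = trunc g m (- i) v (2*g+1-m)"
  proof -
    have "age g (- i) (2*g+1-m) = 2 * int g - 1 - age g i m" by (rule age_dual[OF g m])
    moreover have "age g (- i) m = 2 * int g - 1 - age g i (2*g+1-m)"
      using age_dual[OF g mem(1), of i] mem(2) by simp
    ultimately show ?thesis by (simp add: trunc_def)
  qed
  define a where "a = std_form g (?h (- i)) x"
  define b where "b = std_form g (?h i) y"
  define c where "c = trunc g m i v (2*g+1-m)"
  have ta: "std_form g (trunc g m (- i) (v(m := 0))) x = a - c * (?s * x m)"
    unfolding trunc_upd_dual[OF m] std_form_simps std_form_apply_left_dual[OF m] a_def c_def sym by simp
  have tb: "std_form g (trunc g m (- (- i)) (v(m := 0))) y = b - c * (?s * y m)"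
    unfolding trunc_upd_dual[OF m] std_form_simps std_form_apply_left_dual[OF m] b_def c_def by simp
  have xa: "std_form g x (?h (- i)) = - a" unfolding a_def by (rule std_form_skew)
  show ?thesis unfolding unipotent_def ta tb std_form_simps std_form_apply_left_dual[OF m]
      std_form_apply_right_dual[OF m] hh ee hm xa b_def[symmetric]
    by (simp add: algebra_simps)
qed

lemma unipotent_step:
  fixes v :: "nat \<Rightarrow> 'k::field"
  assumes g: "g \<ge> 1" and m: "m \<in> {1..2*g}" and v: "v \<in> coord_space g"
  shows "chain_step g i (unipotent g m v (i + 1) x) = unipotent g m v i (chain_step g i x)"
proof -
  let ?m = "2*g+1-m"
  let ?dm = "2 * int g dvd int m + i" and ?dm' = "2 * int g dvd int ?m + i"
  have vc: "v(m := 0, ?m := 0) \<in> coord_space g" "v(m := 0) \<in> coord_space g"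
    using v by (auto simp: coord_space_def)
  have 1: "chain_step g i (trunc g m (i + 1) (v(m := 0, ?m := 0)))
      = (if ?dm then 0 else trunc g m i (v(m := 0, ?m := 0)))"
    by (rule chain_step_trunc[OF g m vc(1)]) simp
  have 2: "chain_step g (- i - 1) (trunc g m (- i) (v(m := 0)))
      = (if ?dm' then 0 else trunc g m (- (i + 1)) (v(m := 0)))"
  proof -
    have e: "- i - 1 + 1 = - i" "- (i + 1) = - i - 1" by simp_all
    have "(v(m := 0)) m = 0" by simp
    from chain_step_trunc[OF g m vc(2) this, of "- i - 1"]
    show ?thesis unfolding dies_dual[OF m] e .
  qed
  have 3: "chain_step g i (unit_vec ?m) = (if ?dm' then 0 else unit_vec ?m :: nat \<Rightarrow> 'k)"
    by (auto simp: chain_step_def unit_vec_def fun_eq_iff)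
  have 4: "chain_step g i x m = (if ?dm then 0 else x m)" by (simp add: chain_step_def)
  show ?thesis
    unfolding unipotent_def chain_step_simps chain_step_adjoint 1 2 3 4
    by (cases ?dm; cases ?dm') (simp_all only: if_True if_False std_form_simps cv.scale_zero_left
        cv.scale_zero_right mult_zero_right)
qed

lemma chain_aut_unipotent:
  fixes v :: "nat \<Rightarrow> 'k::field"
  assumes g: "g \<ge> 1" and m: "m \<in> {1..2*g}" and v: "v \<in> coord_space g"
  shows "chain_aut g (unipotent g m v)"
  unfolding chain_aut_def
proof (intro conjI allI ballI impI)
  fix i
  show "linear_on coord_smult coord_smult (coord_space g) (unipotent g m v i)"
    unfolding linear_on_def unipotent_def std_form_simps
    by (auto simp: coord_smult_def fun_eq_iff algebra_simps)
  have v': "- v \<in> coord_space g" using v by (auto simp: coord_space_def)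
  show "bij_betw (unipotent g m v i) (coord_space g) (coord_space g)"
    using unipotent_inverse[OF g m, of v i] unipotent_inverse[OF g m, of "- v" i]
      unipotent_in_coord_space[OF m v] unipotent_in_coord_space[OF m v']
    by (intro bij_betw_byWitness[where f' = "unipotent g m (- v) i"]) auto
next
  fix i j assume d: "2 * int g dvd i - j"
  hence d': "2 * int g dvd - i - - j" using dvd_minus_iff[of "2 * int g" "i - j"] by (simp add: algebra_simps)
  show "unipotent g m v i = unipotent g m v j"
    by (simp add: unipotent_def fun_eq_iff trunc_def age_cong[OF d] age_cong[OF d'])
qed (use unipotent_form[OF g m] unipotent_step[OF g m v] in auto)

text \<open>At index \<open>j\<close> nothing of \<open>v\<close> is truncated. So the second summand cancels all coordinates but the two at \<open>m\<close>
  and \<open>2g+1-m\<close>, and the latter disappears because \<open>v\<close> is orthogonal to its own truncation at \<open>-j\<close>.\<close>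

lemma unipotent_normalizes:
  fixes v :: "nat \<Rightarrow> 'k::field"
  assumes g: "g \<ge> 1" and m: "m \<in> {1..2*g}" and v: "v \<in> coord_space g" "v m = 1"
    and age: "\<And>n. v n \<noteq> 0 \<Longrightarrow> age g j m \<le> age g j n"
  shows "unipotent g m v j v = unit_vec m"
proof -
  let ?m = "2*g+1-m"
  have t: "trunc g m j v = v" using age by (auto simp: trunc_def fun_eq_iff)
  have t': "trunc g m j (v(m := 0, ?m := 0)) = v(m := 0, ?m := 0)"
    using age by (auto simp: trunc_def fun_eq_iff)
  have "trunc g m (- j) v = trunc g m (- j) (v(m := 0)) + unit_vec m"
    using v(2) by (auto simp: trunc_def fun_eq_iff unit_vec_def)
  hence "std_form g (trunc g m (- j) (v(m := 0))) v + std_form g (unit_vec m) v = 0"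
    using std_form_trunc[OF g m, of j v] t by (simp add: std_form_simps)
  hence "pol_sign g m * std_form g (trunc g m (- j) (v(m := 0))) v = - v ?m"
    unfolding std_form_unit_left[OF m] by (simp add: eq_neg_iff_add_eq_0[symmetric])
  hence "unipotent g m v j v = v - v(m := 0, ?m := 0) - coord_smult (v ?m) (unit_vec ?m)"
    unfolding unipotent_def t' using v(2) by (simp add: coord_smult_def fun_eq_iff)
  thus ?thesis using v(2) dual_index(3)[OF m] by (auto simp: fun_eq_iff unit_vec_def coord_smult_def)
qed

section \<open>Splitting a self-dual chain into coordinate lines\<close>

definition split_along :: "nat set \<Rightarrow> (int \<Rightarrow> (nat \<Rightarrow> 'k::field) set) \<Rightarrow> bool" where
  "split_along D L \<longleftrightarrow> (\<forall>i. \<forall>x\<in>L i. \<forall>m\<in>D. coord_smult (x m) (unit_vec m) \<in> L i)"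

text \<open>Following the chain from \<open>j\<close> the vector \<open>e\<^sub>m\<close> reaches every index at which it is at least as old as at \<open>j\<close>
  before it is killed.\<close>

lemma unit_vec_propagates:
  assumes g: "g \<ge> 1" and L: "self_dual_chain g L"
    and j: "unit_vec m \<in> L j" and age: "age g j m \<le> age g i m"
  shows "unit_vec m \<in> L i"
proof -
  have *: "int k \<le> 2 * int g - 1 - age g j m \<Longrightarrow>
      unit_vec m \<in> L (j - int k) \<and> age g (j - int k) m = age g j m + int k" for k
  proof (induction k)
    case (Suc k)
    define l where "l = j - int (Suc k)"
    have l: "j - int k = l + 1" by (simp add: l_def)
    have IH: "unit_vec m \<in> L (l + 1)" "age g (l + 1) m = age g j m + int k"
      using Suc unfolding l by auto
    have alive: "\<not> 2 * int g dvd int m + l"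
      using age_dies[OF g, of m l] IH(2) Suc.prems by auto
    have "chain_step g l (unit_vec m) = (unit_vec m :: nat \<Rightarrow> 'a)"
      using alive by (auto simp: chain_step_def unit_vec_def fun_eq_iff)
    hence "unit_vec m \<in> L l" using self_dual_chainD(3)[OF L IH(1)] by simp
    thus ?case using age_survives[OF g alive] IH(2) by (simp add: l_def)
  qed (use j in auto)
  define k where "k = nat (age g i m - age g j m)"
  have k: "int k = age g i m - age g j m" using age by (simp add: k_def)
  have "unit_vec m \<in> L (j - int k)" "age g (j - int k) m = age g i m"
    using *[of k] k age_bounds[OF g, of i m] by auto
  thus ?thesis using self_dual_chainD(5)[OF L age_eq_imp_dvd] by metis
qed

text \<open>After \<open>v\<close> has been moved to \<open>e\<^sub>m\<close>, minimality of the age and propagation along the chain put \<open>e\<^sub>m\<close> into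
  each member of the family that is not contained in the hyperplane \<open>x\<^sub>m = 0\<close>. For the dual coordinate use
  that the member at \<open>i\<close> is the complement of the one at \<open>-i\<close>: either the latter lies in \<open>x\<^sub>m = 0\<close>, and then
  \<open>e\<^bsub>2g+1-m\<^esub>\<close> is orthogonal to it, or it contains \<open>e\<^sub>m\<close>, and then the former lies in \<open>x\<^bsub>2g+1-m\<^esub> = 0\<close>. The
  automorphism leaves the lines in \<open>D\<close> alone because \<open>v\<close> has no coordinates there.\<close>

lemma split_step:
  fixes L :: "int \<Rightarrow> (nat \<Rightarrow> 'k::field) set"
  assumes g: "g \<ge> 1" and L: "self_dual_chain g L" and spl: "split_along D L"
    and D: "D \<subseteq> {1..2*g}" "\<And>n. n \<in> D \<Longrightarrow> 2*g+1-n \<in> D"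
    and x: "x \<in> L j" "m \<in> {1..2*g} - D" "x m \<noteq> 0"
    and least: "\<And>i y n. y \<in> L i \<Longrightarrow> n \<in> {1..2*g} - D \<Longrightarrow> y n \<noteq> 0 \<Longrightarrow> age g j m \<le> age g i n"
  shows "\<exists>\<gamma>. chain_aut g \<gamma> \<and> split_along (insert m (insert (2*g+1-m) D)) (\<lambda>i. \<gamma> i ` L i)"
proof -
  let ?m = "2*g+1-m"
  have m: "m \<in> {1..2*g}" "m \<notin> D" using x(2) by auto
  have m': "?m \<in> {1..2*g}" "2*g+1-?m = m" using m by auto
  have m'D: "?m \<notin> D" using D(2)[of ?m] m m'(2) by auto
  have finD: "finite D" using D(1) finite_subset by blast
  \<comment> \<open>\<open>x\<close> normalised at \<open>m\<close> and freed of its components in the lines that have already been split off\<close>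
  define v where "v = coord_smult (1 / x m) (x - (\<Sum>n\<in>D. coord_smult (x n) (unit_vec n)))"
  have v_at: "v n = (if n \<in> D then 0 else x n / x m)" for n
  proof -
    have "(\<Sum>k\<in>D. coord_smult (x k) (unit_vec k) n) = (\<Sum>k\<in>D. if k = n then x n else 0)"
      by (rule sum.cong) (auto simp: coord_smult_def unit_vec_def)
    thus ?thesis using finD by (simp add: v_def coord_smult_def sum_fun_apply)
  qed
  have "coord_smult (x n) (unit_vec n) \<in> L j" if "n \<in> D" for n
    using spl x(1) that unfolding split_along_def by blast
  hence vL: "v \<in> L j" unfolding v_def
    by (rule cv.subspace_scale[OF self_dual_chainD(1)[OF L] cv.subspace_diff[OF self_dual_chainD(1)[OF L] x(1)
        cv.subspace_sum[OF self_dual_chainD(1)[OF L]]]])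
  have vc: "v \<in> coord_space g" using vL self_dual_chainD(2)[OF L] by blast
  have v_age: "age g j m \<le> age g j n" if "v n \<noteq> 0" for n
  proof -
    have "n \<in> {1..2*g}" using that vc by (auto simp: coord_space_def)
    thus ?thesis using least[OF x(1), of n] that by (auto simp: v_at split: if_splits)
  qed
  define \<gamma> where "\<gamma> = unipotent g m v"
  define M where "M = (\<lambda>i. \<gamma> i ` L i)"
  have \<gamma>: "chain_aut g \<gamma>" unfolding \<gamma>_def by (rule chain_aut_unipotent[OF g m(1) vc])
  have M: "self_dual_chain g M" unfolding M_def by (rule self_dual_chain_image[OF \<gamma> L])
  have "\<gamma> j v = unit_vec m" unfolding \<gamma>_def
    using unipotent_normalizes[OF g m(1) vc _ v_age] x(3) m(2) by (simp add: v_at)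
  hence mj: "unit_vec m \<in> M j" using vL unfolding M_def by (metis image_eqI)
  have mi: "unit_vec m \<in> M i" if y: "y \<in> M i" "y m \<noteq> 0" for i y
  proof -
    obtain z where z: "z \<in> L i" "y = \<gamma> i z" using y(1) by (auto simp: M_def)
    hence "z m \<noteq> 0" using y(2) by (simp add: \<gamma>_def unipotent_at[OF m(1)])
    hence "age g j m \<le> age g i m" using least[OF z(1)] m by auto
    thus ?thesis by (rule unit_vec_propagates[OF g M mj])
  qed
  have zero: "coord_smult 0 w \<in> M i" for w i
    using cv.subspace_0[OF self_dual_chainD(1)[OF M]] by simp
  have "coord_smult (y n) (unit_vec n) \<in> M i" if y: "y \<in> M i" and n: "n \<in> insert m (insert ?m D)" for i y n
  proof -
    have sc: "coord_smult (y n) (unit_vec n) \<in> M i" if "y n \<noteq> 0 \<Longrightarrow> unit_vec n \<in> M i"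
      using that zero by (cases "y n = 0") (auto intro: cv.subspace_scale[OF self_dual_chainD(1)[OF M]])
    from n consider "n = m" | "n = ?m" | "n \<in> D" by blast
    thus ?thesis
    proof cases
      case 1
      thus ?thesis using sc mi[OF y] by simp
    next
      case 2
      show ?thesis
      proof (rule sc)
        assume yn: "y n \<noteq> 0"
        have Mi: "M i = std_perp g (M (- i))" using self_dual_chainD(4)[OF M, of "- i"] by simp
        have "std_form g z (unit_vec n) = 0" if z: "z \<in> M (- i)" for z
        proof (rule ccontr)
          assume "std_form g z (unit_vec n) \<noteq> 0"
          hence "z m \<noteq> 0" unfolding 2 std_form_apply_right_dual[OF m(1)] by auto
          hence "unit_vec m \<in> M (- i)" by (rule mi[OF z])
          hence "std_form g (unit_vec m) y = 0" using y unfolding Mi std_perp_def by blast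
          thus False using yn unfolding std_form_unit_left[OF m(1)] 2 by simp
        qed
        thus "unit_vec n \<in> M i" unfolding Mi std_perp_def
          using unit_vec_in_coord_space[OF m'(1)] 2 by simp
      qed
    next
      case 3
      obtain z where z: "z \<in> L i" "y = \<gamma> i z" using y by (auto simp: M_def)
      have nm: "n \<noteq> m" "n \<noteq> ?m" "2*g+1-n \<in> D" "n \<in> {1..2*g}" using 3 m m'D D by auto
      have yn: "y n = z n" using v_at[of n] 3 unfolding z(2) \<gamma>_def unipotent_other[OF nm(1,2)]
        by (simp add: trunc_def)
      have "trunc g m (- i) (v(m := 0)) (2*g+1-n) = 0"
        using v_at[of "2*g+1-n"] nm(3) by (simp add: trunc_def)
      hence "std_form g (trunc g m (- i) (v(m := 0))) (unit_vec n) = 0"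
        unfolding std_form_unit_right[OF nm(4)] by simp
      hence "\<gamma> i (coord_smult (z n) (unit_vec n)) = coord_smult (z n) (unit_vec n)"
        unfolding \<gamma>_def unipotent_def std_form_simps
        using nm(1) by (simp add: coord_smult_def unit_vec_def)
      moreover have "coord_smult (z n) (unit_vec n) \<in> L i" using spl z(1) 3 by (auto simp: split_along_def)
      ultimately show ?thesis unfolding yn M_def by (metis image_eqI)
    qed
  qed
  hence "split_along (insert m (insert ?m D)) (\<lambda>i. \<gamma> i ` L i)" by (simp add: split_along_def M_def)
  thus ?thesis using \<gamma> by blast
qed

text \<open>Induction on the number of coordinates that have not been split off yet, always with a vector and a
  coordinate of least age.\<close>

lemma ex_splitting_aut:
  fixes L :: "int \<Rightarrow> (nat \<Rightarrow> 'k::field) set"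
  assumes g: "g \<ge> 1" and L: "self_dual_chain g L" and "split_along D L"
    and "D \<subseteq> {1..2*g}" "\<And>n. n \<in> D \<Longrightarrow> 2*g+1-n \<in> D"
  shows "\<exists>\<gamma>. chain_aut g \<gamma> \<and> split_along {1..2*g} (\<lambda>i. \<gamma> i ` L i)"
  using assms(2-)
proof (induction "card ({1..2*g} - D)" arbitrary: D L rule: less_induct)
  case less
  define P where "P = (\<lambda>(i, y, n). y \<in> L i \<and> n \<in> {1..2*g} - D \<and> y n \<noteq> 0)"
  show ?case
  proof (cases "\<exists>t. P t")
    case False
    \<comment> \<open>all members vanish off \<open>D\<close>, so the remaining coordinates contribute only zero vectors\<close>
    have "coord_smult (x m) (unit_vec m) \<in> L i" if "x \<in> L i" "m \<in> {1..2*g}" for i x m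
    proof (cases "m \<in> D")
      case False
      hence "x m = 0" using \<open>\<not> (\<exists>t. P t)\<close> that by (auto simp: P_def)
      thus ?thesis using cv.subspace_0[OF self_dual_chainD(1)[OF less.prems(1)]] by simp
    qed (use less.prems(2) that in \<open>auto simp: split_along_def\<close>)
    hence "split_along {1..2*g} L" by (simp add: split_along_def)
    thus ?thesis using chain_aut_id by (intro exI[of _ "\<lambda>i x. x"]) simp
  next
    case True
    then obtain t where t: "P t" "\<And>t'. P t' \<Longrightarrow> (\<lambda>(i, y, n). nat (age g i n)) t \<le> (\<lambda>(i, y, n). nat (age g i n)) t'"
      using ex_has_least_nat[of P _ "\<lambda>(i, y, n). nat (age g i n)"] by blast
    obtain j x m where jxm: "t = (j, x, m)" by (cases t)
    have x: "x \<in> L j" "m \<in> {1..2*g} - D" "x m \<noteq> 0" using t(1) by (auto simp: P_def jxm)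
    have least: "age g j m \<le> age g i n" if "y \<in> L i" "n \<in> {1..2*g} - D" "y n \<noteq> 0" for i y n
      using t(2)[of "(i, y, n)"] that age_bounds(1)[OF g, of j m] age_bounds(1)[OF g, of i n]
      by (auto simp: P_def jxm)
    have "\<exists>\<gamma>. chain_aut g \<gamma> \<and> split_along (insert m (insert (2*g+1-m) D)) (\<lambda>i. \<gamma> i ` L i)"
    proof (rule split_step[OF g less.prems(1-3) _ x])
      show "2*g+1-n \<in> D" if "n \<in> D" for n using that by (rule less.prems(4))
      show "age g j m \<le> age g i n" if "y \<in> L i" "n \<in> {1..2*g} - D" "y n \<noteq> 0" for i y n
        using that by (rule least)
    qed
    then obtain \<gamma> where \<gamma>: "chain_aut g \<gamma>"
      "split_along (insert m (insert (2*g+1-m) D)) (\<lambda>i. \<gamma> i ` L i)" by blast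
    let ?D = "insert m (insert (2*g+1-m) D)"
    have 1: "?D \<subseteq> {1..2*g}" using x(2) less.prems(3) by auto
    have 2: "2*g+1-n \<in> ?D" if "n \<in> ?D" for n using that x(2) less.prems(4) by auto
    have "{1..2*g} - ?D \<subset> {1..2*g} - D" using x(2) by blast
    hence "card ({1..2*g} - ?D) < card ({1..2*g} - D)" by (intro psubset_card_mono) auto
    from less.hyps[OF this self_dual_chain_image[OF \<gamma>(1) less.prems(1)] \<gamma>(2) 1 2]
    obtain \<delta> where \<delta>: "chain_aut g \<delta>" "split_along {1..2*g} (\<lambda>i. \<delta> i ` \<gamma> i ` L i)" by blast
    thus ?thesis using chain_aut_comp[OF \<gamma>(1) \<delta>(1)]
      by (intro exI[of _ "\<lambda>i x. \<delta> i (\<gamma> i x)"]) (simp add: image_image)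
  qed
qed

section \<open>Completing a half chain by duality\<close>

text \<open>The value at \<open>-r\<close> for \<open>0 \<le> r \<le> g\<close> is the complement of \<open>L r\<close>. At \<open>r = 0\<close> and \<open>r = g\<close>, where \<open>r\<close> and
  \<open>-r\<close> are the same index, this is consistent only if \<open>L 0\<close> and \<open>L g\<close> are Lagrangian.\<close>

definition extend_chain :: "nat \<Rightarrow> (nat \<Rightarrow> (nat \<Rightarrow> 'k::field) set) \<Rightarrow> int \<Rightarrow> (nat \<Rightarrow> 'k) set" where
  "extend_chain g L i =
     (if i mod (2 * int g) \<le> int g then L (nat (i mod (2 * int g)))
      else std_perp g (L (nat (2 * int g - i mod (2 * int g)))))"

lemma extend_chain_pos:
  assumes "g \<ge> 1" "r \<le> g" "2 * int g dvd i - int r"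
  shows "extend_chain g L i = L r"
proof -
  have "i mod (2 * int g) = int r mod (2 * int g)" using assms(3) by (simp add: mod_eq_dvd_iff)
  also have "\<dots> = int r" using assms by (intro mod_pos_pos_trivial) auto
  finally show ?thesis using assms(2) by (simp add: extend_chain_def)
qed

lemma extend_chain_neg:
  assumes "g \<ge> 1" "r \<le> g" "2 * int g dvd i + int r"
    and "std_perp g (L 0) = L 0" "std_perp g (L g) = L g"
  shows "extend_chain g L i = std_perp g (L r)"
proof (cases "r = 0 \<or> r = g")
  case True
  have "2 * int g dvd i - int r"
  proof (cases "r = 0")
    case False
    hence "i - int r = i + int r - 2 * int g" using True by simp
    thus ?thesis using assms(3) by (metis dvd_diff dvd_refl)
  qed (use assms(3) in simp)
  thus ?thesis using extend_chain_pos[OF assms(1,2)] True assms(4,5) by auto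
next
  case False
  have "i - (2 * int g - int r) = (i + int r) - 2 * int g" by simp
  hence "2 * int g dvd i - (2 * int g - int r)"
    using dvd_diff[OF assms(3) dvd_refl] by (simp only:)
  hence "i mod (2 * int g) = (2 * int g - int r) mod (2 * int g)" by (simp only: mod_eq_dvd_iff)
  also have "\<dots> = 2 * int g - int r" using assms False by (intro mod_pos_pos_trivial) auto
  finally show ?thesis using assms(2) False by (simp add: extend_chain_def)
qed

lemma index_cases:
  assumes "g \<ge> 1"
  obtains r where "r < g" "2 * int g dvd i - int r" | r where "1 \<le> r" "r \<le> g" "2 * int g dvd i + int r"
proof (cases "i mod (2 * int g) < int g")
  case True
  define r where "r = nat (i mod (2 * int g))"
  have "int r = i mod (2 * int g)" using assms by (simp add: r_def)
  moreover have "2 * int g dvd i - i mod (2 * int g)" by (simp add: minus_mod_eq_mult_div)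
  ultimately show ?thesis using True that(1)[of r] by simp
next
  case False
  define r where "r = nat (2 * int g - i mod (2 * int g))"
  have b: "i mod (2 * int g) < 2 * int g" using assms by (intro pos_mod_bound) auto
  hence r: "int r = 2 * int g - i mod (2 * int g)" by (simp add: r_def)
  have "2 * int g dvd (i - i mod (2 * int g)) + 2 * int g"
    by (intro dvd_add) (simp_all add: minus_mod_eq_mult_div)
  hence "2 * int g dvd i + int r" by (simp add: r algebra_simps)
  moreover have "1 \<le> r" "r \<le> g" using False b r by linarith+
  ultimately show ?thesis using that(2)[of r] by simp
qed

text \<open>At indices where the family is defined by complements, the chain condition is the transpose of the one
  between \<open>0\<close> and \<open>g\<close>, because each step is adjoint to the step at the opposite index.\<close>

lemma self_dual_extend_chain:
  fixes L :: "nat \<Rightarrow> (nat \<Rightarrow> 'k::field) set"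
  assumes g: "g \<ge> 1"
    and sub: "\<And>i. i \<le> g \<Longrightarrow> cv.subspace (L i)" "\<And>i. i \<le> g \<Longrightarrow> L i \<subseteq> coord_space g"
    and step: "\<And>i x. i < g \<Longrightarrow> x \<in> L (Suc i) \<Longrightarrow> chain_step g (int i) x \<in> L i"
    and ends: "std_perp g (L 0) = L 0" "std_perp g (L g) = L g"
  shows "self_dual_chain g (extend_chain g L)"
  unfolding self_dual_chain_def
proof (intro conjI allI impI)
  note pos = extend_chain_pos[OF g, where L = L] and neg = extend_chain_neg[OF g _ _ ends]
  fix i
  show "cv.subspace (extend_chain g L i)"
  proof (rule index_cases[OF g, of i])
    fix r assume "r < g" "2 * int g dvd i - int r"
    thus ?thesis using sub(1)[of r] pos[of r i] by simp
  next
    fix r assume "1 \<le> r" "r \<le> g" "2 * int g dvd i + int r"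
    thus ?thesis using neg[of r i] subspace_std_perp[of g "L r"] by simp
  qed
  show "extend_chain g L i \<subseteq> coord_space g"
  proof (rule index_cases[OF g, of i])
    fix r assume "r < g" "2 * int g dvd i - int r"
    thus ?thesis using sub(2)[of r] pos[of r i] by simp
  next
    fix r assume "1 \<le> r" "r \<le> g" "2 * int g dvd i + int r"
    thus ?thesis using neg[of r i] by (auto simp: std_perp_def)
  qed
  show "extend_chain g L (- i) = std_perp g (extend_chain g L i)"
  proof (rule index_cases[OF g, of i])
    fix r assume r: "r < g" "2 * int g dvd i - int r"
    hence "2 * int g dvd - i + int r" using dvd_minus_iff[of "2 * int g" "i - int r"] by simp
    thus ?thesis using r pos[of r i] neg[of r "- i"] by simp
  next
    fix r assume r: "1 \<le> r" "r \<le> g" "2 * int g dvd i + int r"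
    hence "2 * int g dvd - i - int r" using dvd_minus_iff[of "2 * int g" "i + int r"] by (simp add: algebra_simps)
    thus ?thesis using r pos[of r "- i"] neg[of r i] std_perp_std_perp[OF sub] by simp
  qed
  show "chain_step g i ` extend_chain g L (i + 1) \<subseteq> extend_chain g L i"
  proof (rule index_cases[OF g, of i])
    fix r assume r: "r < g" "2 * int g dvd i - int r"
    have "extend_chain g L (i + 1) = L (Suc r)" using r by (intro pos) auto
    thus ?thesis using r pos[of r i] step[OF r(1)] chain_step_cong[OF r(2), where ?'a='k] by auto
  next
    fix r assume r: "1 \<le> r" "r \<le> g" "2 * int g dvd i + int r"
    have E: "extend_chain g L (i + 1) = std_perp g (L (r - 1))" "extend_chain g L i = std_perp g (L r)"
      using r neg[of "r - 1" "i + 1"] neg[of r i] by (simp_all add: of_nat_diff)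
    have "2 * int g dvd (- i - 1) - int (r - 1)"
      using r dvd_minus_iff[of "2 * int g" "i + int r"] by (simp add: of_nat_diff algebra_simps)
    note sc = chain_step_cong[OF this, where ?'a='k]
    show ?thesis unfolding E
    proof clarify
      fix x assume x: "x \<in> std_perp g (L (r - 1))"
      have "std_form g y (chain_step g i x) = 0" if "y \<in> L r" for y
      proof -
        have "chain_step g (int (r - 1)) y \<in> L (r - 1)" using step[of "r - 1" y] that r by simp
        thus ?thesis unfolding chain_step_adjoint sc using x by (simp add: std_perp_def)
      qed
      thus "chain_step g i x \<in> std_perp g (L r)" using x by (simp add: std_perp_def chain_step_in_coord_space)
    qed
  qed
  fix j assume "2 * int g dvd i - j"
  thus "extend_chain g L i = extend_chain g L j" by (simp add: extend_chain_def mod_eq_dvd_iff[symmetric])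
qed

section \<open>The lattice chain in coordinates\<close>

text \<open>For \<open>0 < i \<le> g\<close> the index \<open>-i\<close> is \<open>2g - i\<close> shifted by one period, which gives one factor \<open>p\<close> that the
  first \<open>2g - i\<close> basis vectors lose again.\<close>

lemma lat_scale_eq:
  assumes "g \<ge> 1" "p > 0" "i \<le> g" "m \<in> {1..2*g}"
  shows "lat_scale p g (- int i) m = (if 2*g - i < m then of_nat p else 1)"
proof (cases "i = 0")
  case False
  have r: "(2 * int g - int i) div (2 * int g) = 0" "(2 * int g - int i) mod (2 * int g) = 2 * int g - int i"
    using assms(3) False by (intro div_pos_pos_trivial mod_pos_pos_trivial; simp)+
  have e: "- int i = (2 * int g - int i) + (- 1) * (2 * int g)" by simp
  have "- int i div (2 * int g) = - 1 + (2 * int g - int i) div (2 * int g)"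
    by (subst e, rule div_mult_self1) (use assms(1) in simp)
  moreover have "- int i mod (2 * int g) = (2 * int g - int i) mod (2 * int g)"
    by (subst e, rule mod_mult_self1)
  ultimately have "- int i div (2 * int g) = - 1" "- int i mod (2 * int g) = 2 * int g - int i"
    by (simp_all only: r add_0_right)
  moreover have "int m \<le> 2 * int g - int i \<longleftrightarrow> \<not> 2*g - i < m" using assms by auto
  ultimately show ?thesis using assms(2) by (simp add: lat_scale_def)
qed (use assms in \<open>simp add: lat_scale_def\<close>)

lemma reduce_simps [simp]:
  "reduce 0 = (0 :: 'k::field)" "reduce 1 = (1 :: 'k)" "reduce (- 1) = (- 1 :: 'k)"
  "reduce (of_nat n) = (of_nat n :: 'k)"
  using quotient_of_int[of "int n"] by (simp_all add: reduce_def rat_uminus_code rat_zero_code rat_one_code of_int_code)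

text \<open>The ratio of the scaling factors is \<open>1\<close>, except for the one coordinate where it is \<open>p\<close>, which is zero in \<open>k\<close>.\<close>

lemma lat_map_eq_step:
  assumes "g \<ge> 1" "p > 0" "CHAR('k::field) = p" "i < g" "x \<in> coord_space g"
  shows "lat_map p g (- int (Suc i)) (- int i) x = chain_step g (int i) (x :: nat \<Rightarrow> 'k)"
proof
  fix n
  have p0: "(of_nat p :: 'k) = 0" using assms(3) of_nat_CHAR by metis
  show "lat_map p g (- int (Suc i)) (- int i) x n = chain_step g (int i) x n"
  proof (cases "n \<in> {1..2*g}")
    case True
    have d: "2 * int g dvd int n + int i \<longleftrightarrow> n = 2*g - i"
    proof
      assume "2 * int g dvd int n + int i"
      moreover have "2 * int g dvd int (2*g - i) + int i" using assms(4) by simp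
      ultimately show "n = 2*g - i" using True assms(4) by (intro dying_unique[of n g "2*g-i" "int i"]) auto
    qed (use assms(4) in simp)
    show ?thesis unfolding lat_map_def chain_step_def d
      using True assms(1,2,4) p0
      by (subst lat_scale_eq, simp_all)+ (auto simp: lat_scale_eq)
  qed (use assms(5) in \<open>auto simp: lat_map_def chain_step_def coord_space_def\<close>)
qed

lemma lat_form_eq_std_form:
  assumes "\<And>m. m \<in> {1..2*g} \<Longrightarrow> c * lat_scale p g i m * lat_scale p g i (2*g+1-m) = 1"
  shows "lat_form p g i c x y = std_form g x (y :: nat \<Rightarrow> 'k::field)"
proof -
  have v: "lat_vec p g i m = coord_smult (lat_scale p g i m) (unit_vec m)" for m
    by (auto simp: lat_vec_def coord_smult_def unit_vec_def fun_eq_iff)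
  have r: "reduce (c * std_form g (lat_vec p g i m) (lat_vec p g i n)) = (if n = 2*g+1-m then pol_sign g m else 0 :: 'k)"
    if m: "m \<in> {1..2*g}" and n: "n \<in> {1..2*g}" for m n
  proof (cases "n = 2*g+1-m")
    case True
    have "c * std_form g (lat_vec p g i m) (lat_vec p g i n)
        = (c * lat_scale p g i m * lat_scale p g i n) * pol_sign g m"
      unfolding v std_form_simps std_form_unit_left[OF m] by (simp add: True unit_vec_def)
    also have "\<dots> = pol_sign g m" using assms[OF m] True by simp
    finally show ?thesis using True by (simp add: pol_sign_def)
  next
    case False
    thus ?thesis unfolding v std_form_simps std_form_unit_left[OF m] by (simp add: unit_vec_def)
  qed
  have "lat_form p g i c x y
      = (\<Sum>m=1..2*g. \<Sum>n=1..2*g. if n = 2*g+1-m then pol_sign g m * x m * y (2*g+1-m) else 0)"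
    unfolding lat_form_def by (intro sum.cong refl) (simp add: r)
  also have "\<dots> = std_form g x y" unfolding std_form_sum
    by (intro sum.cong refl) (subst sum.delta, simp, use dual_index(1) in force)
  finally show ?thesis .
qed

text \<open>At the index \<open>-g\<close> exactly one of \<open>e\<^sub>m\<close> and \<open>e\<^bsub>2g+1-m\<^esub>\<close> is scaled by \<open>p\<close>, which the factor \<open>1/p\<close> of the
  form compensates. So both forms are the standard one.\<close>

lemma lattice_chain_forms:
  assumes "g \<ge> 1" "p > 0"
  shows "ch_form0 (lattice_chain p g) = (std_form g :: (nat \<Rightarrow> 'k::field) \<Rightarrow> _)"
    and "ch_formg (lattice_chain p g) = (std_form g :: (nat \<Rightarrow> 'k::field) \<Rightarrow> _)"
proof -
  have 1: "lat_form p g 0 1 x y = std_form g x y" for x y :: "nat \<Rightarrow> 'k"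
  proof (rule lat_form_eq_std_form)
    fix m assume "m \<in> {1..2*g}"
    thus "1 * lat_scale p g 0 m * lat_scale p g 0 (2*g+1-m) = 1"
      using lat_scale_eq[OF assms, of 0] dual_index(1)[of m g] by auto
  qed
  have 2: "lat_form p g (- int g) (1 / of_nat p) x y = std_form g x y" for x y :: "nat \<Rightarrow> 'k"
  proof (rule lat_form_eq_std_form)
    fix m assume m: "m \<in> {1..2*g}"
    show "1 / of_nat p * lat_scale p g (- int g) m * lat_scale p g (- int g) (2*g+1-m) = 1"
      unfolding lat_scale_eq[OF assms le_refl m] lat_scale_eq[OF assms le_refl dual_index(1)[OF m]]
      using m assms by auto
  qed
  show "ch_form0 (lattice_chain p g) = (std_form g :: (nat \<Rightarrow> 'k::field) \<Rightarrow> _)"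
    and "ch_formg (lattice_chain p g) = (std_form g :: (nat \<Rightarrow> 'k::field) \<Rightarrow> _)"
    by (simp_all add: lattice_chain_def fun_eq_iff 1 2)
qed

text \<open>The form at \<open>g\<close> is preserved because \<open>g\<close> and \<open>-g\<close> are the same index modulo \<open>2g\<close>.\<close>

lemma chain_aut_in_G_I:
  assumes g: "g \<ge> 1" and p: "p > 0" "CHAR('k::field) = p" and \<gamma>: "chain_aut g (\<gamma> :: int \<Rightarrow> (nat \<Rightarrow> 'k) \<Rightarrow> _)"
  shows "(\<lambda>i. \<gamma> (int i)) \<in> G_I p g"
proof -
  let ?C = "lattice_chain p g :: ('k, nat \<Rightarrow> 'k) pol_chain"
  have C: "ch_smult ?C = coord_smult" "ch_space ?C = (\<lambda>i. coord_space g)"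
     "ch_map ?C = (\<lambda>i. lat_map p g (- int (Suc i)) (- int i))" by (simp_all add: lattice_chain_def)
  have maps: "\<gamma> i x \<in> coord_space g" if "x \<in> coord_space g" for i x
    using bij_betwE[OF chain_autD(2)[OF \<gamma>]] that by blast
  have st: "\<gamma> (int i) (lat_map p g (- int (Suc i)) (- int i) x)
      = lat_map p g (- int (Suc i)) (- int i) (\<gamma> (int (Suc i)) x)" if "i < g" "x \<in> coord_space g" for i x
    unfolding lat_map_eq_step[OF g p that] lat_map_eq_step[OF g p that(1) maps[OF that(2)]]
    using chain_autD(3)[OF \<gamma> that(2), of "int i"] by (simp add: add.commute)
  have f0: "std_form g (\<gamma> (int 0) x) (\<gamma> (int 0) y) = 1 * std_form g x y"
    if "x \<in> coord_space g" "y \<in> coord_space g" for x y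
    using chain_autD(4)[OF \<gamma> that, of 0] by simp
  have "\<gamma> (- int g) = \<gamma> (int g)" by (rule chain_autD(5)[OF \<gamma>]) simp
  hence fg: "std_form g (\<gamma> (int g) x) (\<gamma> (int g) y) = 1 * std_form g x y"
    if "x \<in> coord_space g" "y \<in> coord_space g" for x y
    using chain_autD(4)[OF \<gamma> that, of "int g"] by simp
  show ?thesis unfolding G_I_def chain_isos_def C lattice_chain_forms[OF g p(1)] mem_Collect_eq
  proof (intro conjI allI impI ballI)
    show "\<exists>c. c \<noteq> 0 \<and> (\<forall>x\<in>coord_space g. \<forall>y\<in>coord_space g.
        std_form g (\<gamma> (int 0) x) (\<gamma> (int 0) y) = c * std_form g x y)"
      using f0 by (intro exI[of _ 1]) auto
    show "\<exists>c. c \<noteq> 0 \<and> (\<forall>x\<in>coord_space g. \<forall>y\<in>coord_space g.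
        std_form g (\<gamma> (int g) x) (\<gamma> (int g) y) = c * std_form g x y)"
      using fg by (intro exI[of _ 1]) auto
  qed (use st chain_autD(1,2)[OF \<gamma>] in blast)+
qed

lemma coord_span_of_split:
  assumes "cv.subspace L" "L \<subseteq> coord_space g"
    and "\<And>x m. x \<in> L \<Longrightarrow> m \<in> {1..2*g} \<Longrightarrow> coord_smult (x m) (unit_vec m) \<in> L"
  shows "L = coord_span {m \<in> {1..2*g}. unit_vec m \<in> (L :: (nat \<Rightarrow> 'k::field) set)}" (is "L = coord_span ?S")
proof
  show "L \<subseteq> coord_span ?S"
  proof
    fix x assume x: "x \<in> L"
    have "x m = 0" if "m \<notin> ?S" for m
    proof (rule ccontr)
      assume xm: "x m \<noteq> 0"
      hence m: "m \<in> {1..2*g}" using assms(2) x by (auto simp: coord_space_def)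
      have "coord_smult (1 / x m) (coord_smult (x m) (unit_vec m)) \<in> L"
        by (rule cv.subspace_scale[OF assms(1) assms(3)[OF x m]])
      hence "unit_vec m \<in> L" using xm by simp
      thus False using that m by simp
    qed
    thus "x \<in> coord_span ?S" by (simp add: coord_span_def)
  qed
  show "coord_span ?S \<subseteq> L"
  proof
    fix x :: "nat \<Rightarrow> 'k" assume "x \<in> coord_span ?S"
    hence "x = (\<Sum>m\<in>?S. coord_smult (x m) (unit_vec m))" by (intro coord_expansion) auto
    also have "\<dots> \<in> L" by (rule cv.subspace_sum[OF assms(1)], rule cv.subspace_scale[OF assms(1)]) simp
    finally show "x \<in> L" .
  qed
qed

text \<open>The Bruhat decomposition: it suffices to split the completed chain along all coordinates.\<close>

lemma coordinate_normal_form: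
  fixes L :: "nat \<Rightarrow> (nat \<Rightarrow> 'k::field) set"
  assumes g: "g \<ge> 1" and p: "p > 0" "CHAR('k) = p"
    and sub: "\<And>i. i \<le> g \<Longrightarrow> cv.subspace (L i)" "\<And>i. i \<le> g \<Longrightarrow> L i \<subseteq> coord_space g"
    and step: "\<And>i x. i < g \<Longrightarrow> x \<in> L (Suc i) \<Longrightarrow> chain_step g (int i) x \<in> L i"
    and ends: "std_perp g (L 0) = L 0" "std_perp g (L g) = L g"
  shows "\<exists>\<gamma>\<in>G_I p g. \<exists>S. \<forall>i\<le>g. S i \<subseteq> {1..2*g} \<and> \<gamma> i ` L i = coord_span (S i)"
proof -
  have E: "self_dual_chain g (extend_chain g L)" by (rule self_dual_extend_chain[OF g sub step ends])
  obtain \<gamma> where \<gamma>: "chain_aut g \<gamma>" "split_along {1..2*g} (\<lambda>i. \<gamma> i ` extend_chain g L i)"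
    using ex_splitting_aut[OF g E, of "{}"] by (auto simp: split_along_def)
  let ?S = "\<lambda>i. {m \<in> {1..2*g}. unit_vec m \<in> \<gamma> (int i) ` L i}"
  have M: "self_dual_chain g (\<lambda>i. \<gamma> i ` extend_chain g L i)" by (rule self_dual_chain_image[OF \<gamma>(1) E])
  have S: "\<gamma> (int i) ` L i = coord_span (?S i)" if "i \<le> g" for i
  proof -
    have e: "extend_chain g L (int i) = L i" by (rule extend_chain_pos[OF g that]) simp
    show ?thesis
    proof (rule coord_span_of_split)
      show "cv.subspace (\<gamma> (int i) ` L i)" "\<gamma> (int i) ` L i \<subseteq> coord_space g"
        using self_dual_chainD(1,2)[OF M, of "int i"] e by simp_all
      show "coord_smult (x m) (unit_vec m) \<in> \<gamma> (int i) ` L i" if "x \<in> \<gamma> (int i) ` L i" "m \<in> {1..2*g}" for x m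
        using \<gamma>(2) that unfolding split_along_def e[symmetric] by blast
    qed
  qed
  show ?thesis
  proof (intro bexI exI allI impI conjI)
    show "(\<lambda>i. \<gamma> (int i)) \<in> G_I p g" by (rule chain_aut_in_G_I[OF g p \<gamma>(1)])
    show "?S i \<subseteq> {1..2*g}" for i by blast
  qed (rule S)
qed

section \<open>Dimensions and isomorphisms of chains\<close>

text \<open>The map is linear only on \<open>V\<close>, so it is first replaced by a linear map on the whole space that agrees
  with it there.\<close>

lemma dim_image_linear_on:
  fixes s :: "'k::field \<Rightarrow> 'v::ab_group_add \<Rightarrow> 'v" and t :: "'k \<Rightarrow> 'w::ab_group_add \<Rightarrow> 'w"
  assumes s: "vector_space s" and t: "vector_space t"
    and V: "module.subspace s V" and f: "linear_on s t V f" "inj_on f V" and U: "U \<subseteq> V"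
  shows "vector_space.dim t (f ` U) = vector_space.dim s U"
proof -
  interpret p: vector_space_pair s t by (intro vector_space_pair.intro s t)
  obtain B where B: "B \<subseteq> V" "p.vs1.independent B" "V \<subseteq> p.vs1.span B"
    using p.vs1.maximal_independent_subset by blast
  obtain h where h: "Vector_Spaces.linear s t h" "\<And>b. b \<in> B \<Longrightarrow> h b = f b"
    using p.linear_independent_extend[OF B(2), of f] by blast
  interpret h: Vector_Spaces.linear s t h by fact
  have V0: "0 \<in> V" by (rule p.vs1.subspace_0[OF V])
  have f0: "f 0 = 0"
  proof -
    have "f (s 0 0) = t 0 (f 0)" using f(1) V0 unfolding linear_on_def by blast
    thus ?thesis by simp
  qed
  have eq: "h x = f x \<and> x \<in> V" if "x \<in> V" for x
  proof -
    from that B(3) have "x \<in> p.vs1.span B" by blast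
    thus ?thesis
    proof (induction rule: p.vs1.span_induct)
      show "p.vs1.subspace {x. h x = f x \<and> x \<in> V}"
      proof (rule p.vs1.subspaceI)
        show "0 \<in> {x. h x = f x \<and> x \<in> V}" using V0 f0 by simp
        show "x + y \<in> {x. h x = f x \<and> x \<in> V}" if "x \<in> {x. h x = f x \<and> x \<in> V}" "y \<in> {x. h x = f x \<and> x \<in> V}" for x y
          using that f(1) p.vs1.subspace_add[OF V] unfolding linear_on_def by (auto simp: h.add)
        show "s c x \<in> {x. h x = f x \<and> x \<in> V}" if "x \<in> {x. h x = f x \<and> x \<in> V}" for c x
          using that f(1) p.vs1.subspace_scale[OF V] unfolding linear_on_def by (auto simp: h.scale)
      qed
      show "h b = f b \<and> b \<in> V" if "b \<in> B" for b using that h(2) B(1) by blast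
    qed
  qed
  have hU: "h ` U = f ` U" using eq U by (intro image_cong) auto
  have injV: "inj_on h V" using f(2) eq by (auto simp: inj_on_def)
  obtain B' where B': "B' \<subseteq> U" "p.vs1.independent B'" "U \<subseteq> p.vs1.span B'" "card B' = p.vs1.dim U"
    using p.vs1.basis_exists by blast
  have "p.vs1.span B' \<subseteq> V" using B'(1) U V by (intro p.vs1.span_minimal) auto
  hence inj: "inj_on h (p.vs1.span B')" using injV inj_on_subset by blast
  have "p.vs2.independent (h ` B')" by (rule h.independent_injective_image[OF B'(2) inj])
  moreover have "h ` U \<subseteq> p.vs2.span (h ` B')" by (rule h.spans_image[OF B'(3)])
  ultimately have "card (h ` B') = p.vs2.dim (h ` U)"
    using B'(1) by (intro p.vs2.basis_card_eq_dim) auto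
  moreover have "card (h ` B') = card B'"
    using inj p.vs1.span_superset by (intro card_image) (auto intro: inj_on_subset)
  ultimately show ?thesis using B'(4) hU by simp
qed

lemma chain_isos_comp:
  fixes C :: "('k::field, 'u::ab_group_add) pol_chain" and D :: "('k, 'v::ab_group_add) pol_chain"
    and E :: "('k, 'w::ab_group_add) pol_chain"
  assumes "\<xi> \<in> chain_isos g C D" "\<eta> \<in> chain_isos g D E"
  shows "(\<lambda>i x. \<eta> i (\<xi> i x)) \<in> chain_isos g C E"
proof -
  have x: "linear_on (ch_smult C) (ch_smult D) (ch_space C i) (\<xi> i)"
       "bij_betw (\<xi> i) (ch_space C i) (ch_space D i)" if "i \<le> g" for i
    using assms(1) that unfolding chain_isos_def by blast+
  have e: "linear_on (ch_smult D) (ch_smult E) (ch_space D i) (\<eta> i)"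
       "bij_betw (\<eta> i) (ch_space D i) (ch_space E i)" if "i \<le> g" for i
    using assms(2) that unfolding chain_isos_def by blast+
  have maps: "\<xi> i v \<in> ch_space D i" if "i \<le> g" "v \<in> ch_space C i" for i v
    using bij_betwE[OF x(2)[OF that(1)]] that(2) by blast
  have form: "\<exists>c. c \<noteq> 0 \<and> (\<forall>v\<in>ch_space C i. \<forall>w\<in>ch_space C i. h (\<eta> i (\<xi> i v)) (\<eta> i (\<xi> i w)) = c * f v w)"
    if i: "i \<le> g" and 1: "\<exists>c. c \<noteq> 0 \<and> (\<forall>v\<in>ch_space C i. \<forall>w\<in>ch_space C i. k (\<xi> i v) (\<xi> i w) = c * f v w)"
      and 2: "\<exists>c. c \<noteq> 0 \<and> (\<forall>v\<in>ch_space D i. \<forall>w\<in>ch_space D i. h (\<eta> i v) (\<eta> i w) = c * k v w)"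
    for i and f :: "'u \<Rightarrow> 'u \<Rightarrow> 'k" and k :: "'v \<Rightarrow> 'v \<Rightarrow> 'k" and h :: "'w \<Rightarrow> 'w \<Rightarrow> 'k"
  proof -
    obtain c where c: "c \<noteq> 0" "\<And>v w. v \<in> ch_space C i \<Longrightarrow> w \<in> ch_space C i \<Longrightarrow> k (\<xi> i v) (\<xi> i w) = c * f v w"
      using 1 by blast
    obtain d where d: "d \<noteq> 0" "\<And>v w. v \<in> ch_space D i \<Longrightarrow> w \<in> ch_space D i \<Longrightarrow> h (\<eta> i v) (\<eta> i w) = d * k v w"
      using 2 by blast
    show ?thesis using c d maps[OF i] by (intro exI[of _ "d * c"]) simp
  qed
  show ?thesis unfolding chain_isos_def mem_Collect_eq
  proof (intro conjI allI impI ballI)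
    fix i assume i: "i \<le> g"
    show "linear_on (ch_smult C) (ch_smult E) (ch_space C i) (\<lambda>x. \<eta> i (\<xi> i x))"
      using x(1)[OF i] e(1)[OF i] maps[OF i] unfolding linear_on_def by simp
    show "bij_betw (\<lambda>x. \<eta> i (\<xi> i x)) (ch_space C i) (ch_space E i)"
      using bij_betw_trans[OF x(2)[OF i] e(2)[OF i]] by (simp add: comp_def)
  next
    fix i v assume i: "i < g" and v: "v \<in> ch_space C (Suc i)"
    have "\<xi> i (ch_map C i v) = ch_map D i (\<xi> (Suc i) v)" using assms(1) i v by (simp add: chain_isos_def)
    moreover have "\<eta> i (ch_map D i w) = ch_map E i (\<eta> (Suc i) w)" if "w \<in> ch_space D (Suc i)" for w
      using assms(2) i that by (simp add: chain_isos_def)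
    ultimately show "\<eta> i (\<xi> i (ch_map C i v)) = ch_map E i (\<eta> (Suc i) (\<xi> (Suc i) v))"
      using maps[of "Suc i" v] i v by simp
  next
    show "\<exists>c. c \<noteq> 0 \<and> (\<forall>x\<in>ch_space C 0. \<forall>y\<in>ch_space C 0.
        ch_form0 E (\<eta> 0 (\<xi> 0 x)) (\<eta> 0 (\<xi> 0 y)) = c * ch_form0 C x y)"
      by (rule form[where k = "ch_form0 D"]) (use assms in \<open>simp_all add: chain_isos_def\<close>)
    show "\<exists>c. c \<noteq> 0 \<and> (\<forall>x\<in>ch_space C g. \<forall>y\<in>ch_space C g.
        ch_formg E (\<eta> g (\<xi> g x)) (\<eta> g (\<xi> g y)) = c * ch_formg C x y)"
      by (rule form[where k = "ch_formg D"]) (use assms in \<open>simp_all add: chain_isos_def\<close>)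
  qed
qed

section \<open>Numerical invariants of coordinate chains\<close>

text \<open>The coordinates deleted by \<open>\<alpha>\<^bsub>ji\<^esub>\<close>.\<close>

definition killed :: "nat \<Rightarrow> nat \<Rightarrow> nat \<Rightarrow> nat set" where
  "killed g j i = {2*g-i<..2*g-j}"

definition kill :: "nat set \<Rightarrow> (nat \<Rightarrow> 'k::field) \<Rightarrow> (nat \<Rightarrow> 'k)" where
  "kill K x = (\<lambda>n. if n \<in> K then 0 else x n)"

lemma kill_coord_span: "kill K ` coord_span S = (coord_span (S - K) :: (nat \<Rightarrow> 'k::field) set)"
proof
  show "coord_span (S - K) \<subseteq> kill K ` (coord_span S :: (nat \<Rightarrow> 'k) set)"
  proof
    fix x :: "nat \<Rightarrow> 'k" assume "x \<in> coord_span (S - K)"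
    hence "x = kill K x" "x \<in> coord_span S" by (auto simp: kill_def coord_span_def fun_eq_iff)
    thus "x \<in> kill K ` coord_span S" by blast
  qed
qed (auto simp: kill_def coord_span_def)

lemma subspace_sum_coord_span: "subspace_sum (coord_span S) (coord_span R) = (coord_span (S \<union> R) :: (nat \<Rightarrow> 'k::field) set)"
proof
  show "coord_span (S \<union> R) \<subseteq> (subspace_sum (coord_span S) (coord_span R) :: (nat \<Rightarrow> 'k) set)"
  proof
    fix x :: "nat \<Rightarrow> 'k" assume x: "x \<in> coord_span (S \<union> R)"
    have "x = kill (- S) x + kill S x" "kill (- S) x \<in> coord_span S" "kill S x \<in> coord_span R"
      using x by (auto simp: kill_def coord_span_def fun_eq_iff)
    thus "x \<in> subspace_sum (coord_span S) (coord_span R)" unfolding subspace_sum_def by blast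
  qed
qed (auto simp: subspace_sum_def coord_span_def)

lemma std_perp_coord_span:
  assumes "S \<subseteq> {1..2*g}"
  shows "std_perp g (coord_span S) = (coord_span {n \<in> {1..2*g}. 2*g+1-n \<notin> S} :: (nat \<Rightarrow> 'k::field) set)"
proof (intro Set.set_eqI iffI)
  fix y :: "nat \<Rightarrow> 'k" assume y: "y \<in> std_perp g (coord_span S)"
  have "y n = 0" if n: "n \<in> {1..2*g}" "2*g+1-n \<in> S" for n
  proof -
    have "unit_vec (2*g+1-n) \<in> (coord_span S :: (nat \<Rightarrow> 'k) set)" using n(2) by (auto simp: coord_span_def unit_vec_def)
    hence "std_form g (unit_vec (2*g+1-n)) y = 0" using y by (simp add: std_perp_def)
    thus ?thesis unfolding std_form_apply_left_dual[OF n(1)] by simp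
  qed
  thus "y \<in> coord_span {n \<in> {1..2*g}. 2*g+1-n \<notin> S}"
    using y by (auto simp: std_perp_def coord_space_def coord_span_def)
next
  fix y :: "nat \<Rightarrow> 'k" assume y: "y \<in> coord_span {n \<in> {1..2*g}. 2*g+1-n \<notin> S}"
  have "std_form g x y = 0" if x: "x \<in> coord_span S" for x
    unfolding std_form_sum
  proof (rule sum.neutral, intro ballI)
    fix n assume n: "n \<in> {1..2*g}"
    show "pol_sign g n * x n * y (2*g+1-n) = 0"
    proof (cases "n \<in> S")
      case True
      hence "y (2*g+1-n) = 0" using y dual_index(2)[OF n] unfolding coord_span_def by auto
      thus ?thesis by simp
    qed (use x in \<open>simp add: coord_span_def\<close>)
  qed
  moreover have "y \<in> coord_space g" using y by (auto simp: coord_space_def coord_span_def)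
  ultimately show "y \<in> std_perp g (coord_span S)" by (simp add: std_perp_def)
qed

lemma mem_iff_card_Int:
  assumes "finite K" "n \<notin> K"
  shows "n \<in> S \<longleftrightarrow> card (insert n K \<inter> S) \<noteq> card (K \<inter> S)"
  using assms by (auto simp: Int_insert_left)

text \<open>Whether \<open>n\<close> belongs to \<open>S\<^sub>i\<close> can be read off from the counts for two intervals that differ by \<open>n\<close>. The first
  family of numbers yields such intervals for the coordinates above \<open>2g - i\<close>, the second for those between
  \<open>g\<close> and \<open>2g - i\<close>, the third for those up to \<open>g\<close>.\<close>

lemma coordinate_chain_determined:
  assumes S: "\<And>i. i \<le> g \<Longrightarrow> S i \<subseteq> {1..2*g}" "\<And>i. i \<le> g \<Longrightarrow> S' i \<subseteq> {1..2*g}"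
    and 1: "\<And>i j. j < i \<Longrightarrow> i \<le> g \<Longrightarrow> card (killed g j i \<inter> S i) = card (killed g j i \<inter> S' i)"
    and 2: "\<And>i j. j < i \<Longrightarrow> i \<le> g \<Longrightarrow> card (killed g j i \<inter> S j) = card (killed g j i \<inter> S' j)"
    and 3: "\<And>i j. i \<le> g \<Longrightarrow> j \<le> g \<Longrightarrow> card ({1..j} \<union> (S i - killed g 0 i)) = card ({1..j} \<union> (S' i - killed g 0 i))"
    and i: "i \<le> g"
  shows "S i = S' i"
proof -
  have one: "card (killed g j i \<inter> S i) = card (killed g j i \<inter> S' i)" if "j \<le> i" for j
    using 1[OF _ i, of j] that by (cases "j = i") (auto simp: killed_def)
  have two: "card (killed g i l \<inter> S i) = card (killed g i l \<inter> S' i)" if "i \<le> l" "l \<le> g" for l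
    using 2[of i l] that by (cases "l = i") (auto simp: killed_def)
  have "n \<in> S i \<longleftrightarrow> n \<in> S' i" if n: "n \<in> {1..2*g}" for n
  proof -
    consider "2*g - i < n" | "g < n" "n \<le> 2*g - i" | "n \<le> g" by linarith
    thus ?thesis
    proof cases
      case 1
      let ?j = "2*g - n"
      have k: "killed g ?j i = insert n (killed g (Suc ?j) i)" "n \<notin> killed g (Suc ?j) i" "finite (killed g (Suc ?j) i)"
        using 1 n i by (auto simp: killed_def)
      show ?thesis unfolding mem_iff_card_Int[OF k(3,2)] k(1)[symmetric] using 1 n i by (simp add: one)
    next
      case 2
      let ?l = "2*g - n"
      have k: "killed g i (Suc ?l) = insert n (killed g i ?l)" "n \<notin> killed g i ?l" "finite (killed g i ?l)"
        using 2 n i by (auto simp: killed_def)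
      show ?thesis unfolding mem_iff_card_Int[OF k(3,2)] k(1)[symmetric] using 2 n i by (simp add: two)
    next
      case 3
      have nk: "n \<notin> killed g 0 i" using 3 i by (auto simp: killed_def)
      have e: "{1..n} = insert n {1..n-1}" using n by auto
      have "n \<in> R i \<longleftrightarrow> card ({1..n} \<union> (R i - killed g 0 i)) = card ({1..n-1} \<union> (R i - killed g 0 i))"
        if R: "R i \<subseteq> {1..2*g}" for R :: "nat \<Rightarrow> nat set"
      proof -
        have fin: "finite ({1..n-1} \<union> (R i - killed g 0 i))" using finite_subset[OF R] by simp
        have mem: "n \<in> {1..n-1} \<union> (R i - killed g 0 i) \<longleftrightarrow> n \<in> R i" using nk n by auto
        show ?thesis unfolding e Un_insert_left card_insert_if[OF fin] mem by simp
      qed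
      thus ?thesis using S[OF i] assms(5)[OF i, of n] assms(5)[OF i, of "n - 1"] 3 by simp
    qed
  qed
  thus ?thesis using S[OF i] by blast
qed

text \<open>The three families of numbers, read off from the subspaces of the standard chain.\<close>

definition inv_omega :: "nat \<Rightarrow> (nat \<Rightarrow> (nat \<Rightarrow> 'k::field) set) \<Rightarrow> nat \<Rightarrow> nat \<Rightarrow> nat" where
  "inv_omega g L j i = cv.dim (L j) - cv.dim (kill (killed g j i) ` L i)"
definition inv_H1 :: "nat \<Rightarrow> (nat \<Rightarrow> (nat \<Rightarrow> 'k::field) set) \<Rightarrow> nat \<Rightarrow> nat \<Rightarrow> nat" where
  "inv_H1 g L j i = cv.dim (coord_space g :: (nat \<Rightarrow> 'k) set)
     - cv.dim (subspace_sum (L j) (kill (killed g j i) ` coord_space g))"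
definition inv_perp :: "nat \<Rightarrow> (nat \<Rightarrow> (nat \<Rightarrow> 'k::field) set) \<Rightarrow> nat \<Rightarrow> nat \<Rightarrow> nat" where
  "inv_perp g L i j = cv.dim (subspace_sum (kill (killed g 0 i) ` L i) (std_perp g (kill (killed g 0 j) ` coord_space g)))"

text \<open>The second invariant counts the complement of \<open>S\<^sub>j\<close> in the killed coordinates, hence the sum in its clause.
  The complement of the image in the third one is spanned by \<open>e\<^sub>1, \<dots>, e\<^sub>j\<close>.\<close>

lemma inv_coord:
  fixes L :: "nat \<Rightarrow> (nat \<Rightarrow> 'k::field) set"
  assumes L: "\<forall>i\<le>g. S i \<subseteq> {1..2*g} \<and> L i = coord_span (S i) \<and> cv.dim (L i) = g"
  shows "j \<le> g \<Longrightarrow> i \<le> g \<Longrightarrow> card (killed g j i \<inter> S i) = inv_omega g L j i"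
    and "j < i \<Longrightarrow> i \<le> g \<Longrightarrow> card (killed g j i \<inter> S j) + inv_H1 g L j i = card (killed g j i)"
    and "j \<le> g \<Longrightarrow> i \<le> g \<Longrightarrow> card ({1..j} \<union> (S i - killed g 0 i)) = inv_perp g L i j"
proof -
  have S: "S i \<subseteq> {1..2*g}" "L i = coord_span (S i)" "cv.dim (L i) = g" if "i \<le> g" for i
    using L that by blast+
  have fin: "finite (S i)" if "i \<le> g" for i using finite_subset[OF S(1)[OF that]] by simp
  have card: "card (S i) = g" if "i \<le> g" for i
    using S(3)[OF that] unfolding S(2)[OF that] dim_coord_span[OF fin[OF that]] .
  have kfin: "finite (killed g j i)" "killed g j i \<subseteq> {1..2*g}" if "i \<le> g" for j i by (auto simp: killed_def)
  {
    assume j: "j \<le> g" and i: "i \<le> g"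
    have "card (S i - killed g j i) + card (killed g j i \<inter> S i) = g"
      using card_Diff_subset_Int[of "S i" "killed g j i"] card_mono[OF fin[OF i], of "S i \<inter> killed g j i"] card[OF i] fin[OF i]
      by (simp add: Int_commute)
    moreover have "cv.dim (kill (killed g j i) ` L i) = card (S i - killed g j i)"
      unfolding S(2)[OF i] kill_coord_span using fin[OF i] by (intro dim_coord_span) simp
    ultimately show "card (killed g j i \<inter> S i) = inv_omega g L j i" using S(3)[OF j] by (simp add: inv_omega_def)
  }
  {
    assume ji: "j < i" and i: "i \<le> g"
    hence j: "j \<le> g" by simp
    let ?A = "S j \<union> ({1..2*g} - killed g j i)"
    have "cv.dim (subspace_sum (L j) (kill (killed g j i) ` coord_space g)) = card ?A"
      unfolding S(2)[OF j] kill_coord_span coord_space_eq_span subspace_sum_coord_span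
      using fin[OF j] by (intro dim_coord_span) simp
    moreover have "cv.dim (coord_space g :: (nat \<Rightarrow> 'k) set) = 2 * g"
      unfolding coord_space_eq_span by (subst dim_coord_span) simp_all
    moreover have "card ?A = card ({1..2*g} - (killed g j i - S j))"
      using S(1)[OF j] kfin[OF i, of j] by (intro arg_cong[where f = card]) blast
    moreover have "\<dots> = 2 * g - card (killed g j i - S j)"
      using kfin[OF i, of j] by (subst card_Diff_subset) auto
    moreover have "card (killed g j i - S j) \<le> 2 * g"
      using card_mono[of "{1..2*g}" "killed g j i - S j"] kfin[OF i, of j] by auto
    ultimately have "inv_H1 g L j i = card (killed g j i - S j)" by (simp add: inv_H1_def)
    thus "card (killed g j i \<inter> S j) + inv_H1 g L j i = card (killed g j i)"
      using card_Int_Diff[OF kfin(1)[OF i], of j "S j"] by simp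
  }
  {
    assume j: "j \<le> g" and i: "i \<le> g"
    have "{n \<in> {1..2*g}. 2*g+1-n \<notin> {1..2*g} - killed g 0 j} = {1..j}"
      using j by (auto simp: killed_def)
    hence "std_perp g (kill (killed g 0 j) ` coord_space g) = (coord_span {1..j} :: (nat \<Rightarrow> 'k) set)"
      unfolding coord_space_eq_span kill_coord_span by (subst std_perp_coord_span) auto
    moreover have "cv.dim (coord_span (S i - killed g 0 i \<union> {1..j}) :: (nat \<Rightarrow> 'k) set) = card (S i - killed g 0 i \<union> {1..j})"
      using fin[OF i] by (intro dim_coord_span) simp
    ultimately show "card ({1..j} \<union> (S i - killed g 0 i)) = inv_perp g L i j"
      unfolding inv_perp_def S(2)[OF i] kill_coord_span by (simp add: subspace_sum_coord_span Un_commute)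
  }
qed

lemma coordinate_chains_eqI:
  fixes L L' :: "nat \<Rightarrow> (nat \<Rightarrow> 'k::field) set"
  assumes L: "\<forall>i\<le>g. S i \<subseteq> {1..2*g} \<and> L i = coord_span (S i) \<and> cv.dim (L i) = g"
    and L': "\<forall>i\<le>g. S' i \<subseteq> {1..2*g} \<and> L' i = coord_span (S' i) \<and> cv.dim (L' i) = g"
    and inv: "\<And>i j. j < i \<Longrightarrow> i \<le> g \<Longrightarrow> inv_omega g L j i = inv_omega g L' j i"
      "\<And>i j. j < i \<Longrightarrow> i \<le> g \<Longrightarrow> inv_H1 g L j i = inv_H1 g L' j i"
      "\<And>i j. i \<le> g \<Longrightarrow> j \<le> g \<Longrightarrow> inv_perp g L i j = inv_perp g L' i j"
    and i: "i \<le> g"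
  shows "L i = L' i"
proof -
  note c = inv_coord[OF L] and c' = inv_coord[OF L']
  have "S i = S' i"
  proof (rule coordinate_chain_determined[where S = S and S' = S', OF _ _ _ _ _ i])
    show "S i \<subseteq> {1..2*g}" "S' i \<subseteq> {1..2*g}" if "i \<le> g" for i using L L' that by blast+
  next
    fix i j assume ji: "j < i" and i: "i \<le> g"
    show "card (killed g j i \<inter> S i) = card (killed g j i \<inter> S' i)"
      using c(1)[of j i] c'(1)[of j i] inv(1)[OF ji i] ji i by simp
    show "card (killed g j i \<inter> S j) = card (killed g j i \<inter> S' j)"
      using c(2)[OF ji i] c'(2)[OF ji i] inv(2)[OF ji i] by simp
  next
    fix i j assume i: "i \<le> g" and j: "j \<le> g"
    show "card ({1..j} \<union> (S i - killed g 0 i)) = card ({1..j} \<union> (S' i - killed g 0 i))"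
      using c(3)[OF j i] c'(3)[OF j i] inv(3)[OF i j] by simp
  qed
  thus ?thesis using L L' i by simp
qed

section \<open>Transport from de Rham cohomology\<close>

lemma lattice_chain_simps [simp]:
  "ch_smult (lattice_chain p g) = coord_smult" "ch_space (lattice_chain p g) i = coord_space g"
  "ch_map (lattice_chain p g) i = lat_map p g (- int (Suc i)) (- int i)"
  by (simp_all add: lattice_chain_def)

lemma deRham_chain_simps [simp]:
  "ch_smult (deRham_chain T g X) = dR_smult T" "ch_space (deRham_chain T g X) i = pt_H1 T X i"
  "ch_map (deRham_chain T g X) i = alpha T X i (Suc i)"
  "ch_form0 (deRham_chain T g X) = dR_pairing T (pt_av X 0) (pt_pol0 X)"
  "ch_formg (deRham_chain T g X) = dR_pairing T (pt_av X g) (pt_polg X)"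
  by (simp_all add: deRham_chain_def)

lemma alpha_self: "alpha T X i i = id"
  by (simp add: alpha_def)

lemma alpha_Suc: "j < i \<Longrightarrow> alpha T X j i = dR_pullback T (pt_isog X j) \<circ> alpha T X (Suc j) i"
  by (simp add: alpha_def upt_conv_Cons)

lemma chain_step_kill:
  assumes "j < i" "i \<le> g" "x \<in> coord_space g"
  shows "chain_step g (int j) (kill (killed g (Suc j) i) x) = (kill (killed g j i) x :: nat \<Rightarrow> 'k::field)"
proof
  fix n
  show "chain_step g (int j) (kill (killed g (Suc j) i) x) n = kill (killed g j i) x n"
  proof (cases "n \<in> {1..2*g}")
    case True
    have "2 * int g dvd int n + int j \<longleftrightarrow> n = 2*g - j"
    proof
      assume "2 * int g dvd int n + int j"
      moreover have "2 * int g dvd int (2*g - j) + int j" using assms by simp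
      ultimately show "n = 2*g - j" using True assms by (intro dying_unique[of n g "2*g-j" "int j"]) auto
    qed (use assms in simp)
    thus ?thesis using assms(1,2) by (auto simp: chain_step_def kill_def killed_def)
  next
    case False
    hence "x n = 0" using assms(3) by (simp add: coord_space_def)
    thus ?thesis by (simp add: chain_step_def kill_def)
  qed
qed

context av_deRham_theory
begin

lemma point_facts:
  assumes "X \<in> AI_points T p g N \<zeta>" "i \<le> g"
  shows "pt_av X i \<in> AV T" "av_dim T (pt_av X i) = g"
  using assms by (simp_all add: AI_points_def)

lemma isog_facts:
  assumes "X \<in> AI_points T p g N \<zeta>" "i < g"
  shows "pt_isog X i \<in> isogenies T (pt_av X i) (pt_av X (Suc i))"
  using assms by (simp add: AI_points_def)

lemma alpha_H1:
  assumes X: "X \<in> AI_points T p g N \<zeta>" and "j \<le> i" "i \<le> g" "x \<in> pt_H1 T X i"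
  shows "alpha T X j i x \<in> pt_H1 T X j"
  using \<open>j \<le> i\<close>
proof (induction rule: inc_induct)
  case base
  thus ?case using assms by (simp add: alpha_self)
next
  case (step n)
  have "n < g" using step(2) assms by simp
  hence "dR_pullback T (pt_isog X n) ` pt_H1 T X (Suc n) \<subseteq> pt_H1 T X n"
    by (intro pullback_H1 point_facts[OF X] isog_facts[OF X]) auto
  thus ?case using step by (auto simp: alpha_Suc)
qed

context
  fixes X :: "('a, 'm, 'l, 'q) AI_tuple" and \<xi>
  assumes g: "g \<ge> 1" and p: "p > 0" "CHAR('k) = p"
    and X: "X \<in> AI_points T p g N \<zeta>"
    and \<xi>: "\<xi> \<in> chain_isos g (deRham_chain T g X) (lattice_chain p g)"
begin

lemma iso_linear: "i \<le> g \<Longrightarrow> linear_on (dR_smult T) coord_smult (pt_H1 T X i) (\<xi> i)"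
  using \<xi> unfolding chain_isos_def by simp

lemma iso_bij: "i \<le> g \<Longrightarrow> bij_betw (\<xi> i) (pt_H1 T X i) (coord_space g)"
  using \<xi> unfolding chain_isos_def by simp

lemma iso_in: "i \<le> g \<Longrightarrow> x \<in> pt_H1 T X i \<Longrightarrow> \<xi> i x \<in> coord_space g"
  using bij_betwE[OF iso_bij] by blast

lemma iso_dim: "i \<le> g \<Longrightarrow> U \<subseteq> pt_H1 T X i \<Longrightarrow> cv.dim (\<xi> i ` U) = vector_space.dim (dR_smult T) U"
  by (rule dim_image_linear_on[OF ambient vector_space_coord _ iso_linear])
    (auto intro: H1_subspace point_facts[OF X] bij_betw_imp_inj_on[OF iso_bij])

lemma iso_alpha:
  assumes "j \<le> i" "i \<le> g" "x \<in> pt_H1 T X i"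
  shows "\<xi> j (alpha T X j i x) = kill (killed g j i) (\<xi> i x)"
  using \<open>j \<le> i\<close>
proof (induction rule: inc_induct)
  case base
  thus ?case by (simp add: alpha_self killed_def kill_def)
next
  case (step n)
  have n: "n < g" using step(2) assms by simp
  let ?y = "alpha T X (Suc n) i x"
  have y: "?y \<in> pt_H1 T X (Suc n)" using step(2) assms by (intro alpha_H1[OF X]) auto
  have "\<xi> n (alpha T X n (Suc n) ?y) = lat_map p g (- int (Suc n)) (- int n) (\<xi> (Suc n) ?y)"
    using \<xi> n y unfolding chain_isos_def by simp
  also have "\<dots> = chain_step g (int n) (\<xi> (Suc n) ?y)"
    using n y by (intro lat_map_eq_step[OF g p] iso_in) auto
  also have "\<xi> (Suc n) ?y = kill (killed g (Suc n) i) (\<xi> i x)" by (rule step.IH)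
  also have "chain_step g (int n) \<dots> = kill (killed g n i) (\<xi> i x)"
    using step(2) assms by (intro chain_step_kill iso_in) auto
  finally show ?case using step(2) by (simp add: alpha_Suc alpha_self)
qed

lemma iso_subspace: "i \<le> g \<Longrightarrow> cv.subspace (\<xi> i ` pt_omega T X i)"
  using omega_subspace omega_subset point_facts[OF X]
  by (intro linear_on_image_subspace[OF ambient vector_space_coord iso_linear]) auto

lemma omega_H1: "i \<le> g \<Longrightarrow> pt_omega T X i \<subseteq> pt_H1 T X i"
  by (rule omega_subset[OF point_facts(1)[OF X]])

lemma dim_iso_omega: "i \<le> g \<Longrightarrow> cv.dim (\<xi> i ` pt_omega T X i) = g"
  by (simp add: iso_dim omega_H1 omega_dim point_facts[OF X])

lemma iso_alpha_image:
  assumes "j \<le> i" "i \<le> g" "U \<subseteq> pt_H1 T X i"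
  shows "\<xi> j ` alpha T X j i ` U = kill (killed g j i) ` \<xi> i ` U"
  unfolding image_image using assms by (intro image_cong refl iso_alpha) auto

lemma alpha_image_H1: "j \<le> i \<Longrightarrow> i \<le> g \<Longrightarrow> U \<subseteq> pt_H1 T X i \<Longrightarrow> alpha T X j i ` U \<subseteq> pt_H1 T X j"
  using alpha_H1[OF X] by blast

lemma iso_subspace_sum:
  assumes "i \<le> g" "U \<subseteq> pt_H1 T X i" "W \<subseteq> pt_H1 T X i"
  shows "\<xi> i ` subspace_sum U W = subspace_sum (\<xi> i ` U) (\<xi> i ` W)"
    and "subspace_sum U W \<subseteq> pt_H1 T X i"
proof -
  interpret v: vector_space "dR_smult T" by (rule ambient)
  have add: "\<xi> i (u + w) = \<xi> i u + \<xi> i w" if "u \<in> U" "w \<in> W" for u w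
    using iso_linear[OF assms(1)] assms(2,3) that unfolding linear_on_def by blast
  show "\<xi> i ` subspace_sum U W = subspace_sum (\<xi> i ` U) (\<xi> i ` W)"
  proof
    show "\<xi> i ` subspace_sum U W \<subseteq> subspace_sum (\<xi> i ` U) (\<xi> i ` W)"
      using add unfolding subspace_sum_def by blast
    show "subspace_sum (\<xi> i ` U) (\<xi> i ` W) \<subseteq> \<xi> i ` subspace_sum U W"
    proof
      fix x assume "x \<in> subspace_sum (\<xi> i ` U) (\<xi> i ` W)"
      then obtain u w where uw: "u \<in> U" "w \<in> W" "x = \<xi> i u + \<xi> i w" unfolding subspace_sum_def by blast
      hence "x = \<xi> i (u + w)" "u + w \<in> subspace_sum U W" using add unfolding subspace_sum_def by auto
      thus "x \<in> \<xi> i ` subspace_sum U W" by blast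
    qed
  qed
  show "subspace_sum U W \<subseteq> pt_H1 T X i"
    using v.subspace_add[OF H1_subspace[OF point_facts(1)[OF X assms(1)]]] assms(2,3)
    unfolding subspace_sum_def by blast
qed

lemma iso_perp0:
  assumes "S \<subseteq> pt_H1 T X 0"
  shows "\<xi> 0 ` perp0 T X S = std_perp g (\<xi> 0 ` S)"
proof -
  obtain c where c: "c \<noteq> 0" "\<And>x y. x \<in> pt_H1 T X 0 \<Longrightarrow> y \<in> pt_H1 T X 0 \<Longrightarrow>
      std_form g (\<xi> 0 x) (\<xi> 0 y) = c * dR_pairing T (pt_av X 0) (pt_pol0 X) x y"
    using \<xi> unfolding chain_isos_def by (auto simp: lattice_chain_forms[OF g p(1)])
  have *: "\<xi> 0 x \<in> std_perp g (\<xi> 0 ` S) \<longleftrightarrow> x \<in> perp0 T X S" if x: "x \<in> pt_H1 T X 0" for x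
  proof -
    have "std_form g (\<xi> 0 y) (\<xi> 0 x) = 0 \<longleftrightarrow> dR_pairing T (pt_av X 0) (pt_pol0 X) x y = 0" if "y \<in> S" for y
      using c(2)[OF x, of y] c(1) that assms std_form_skew[of g "\<xi> 0 y" "\<xi> 0 x"] by auto
    thus ?thesis using x iso_in[of 0 x] by (auto simp: std_perp_def perp0_def)
  qed
  moreover have "std_perp g (\<xi> 0 ` S) \<subseteq> \<xi> 0 ` pt_H1 T X 0"
    using bij_betw_imp_surj_on[OF iso_bij[of 0]] by (auto simp: std_perp_def)
  moreover have "perp0 T X S \<subseteq> pt_H1 T X 0" by (auto simp: perp0_def)
  ultimately show ?thesis by blast
qed

lemma dim_quot_omega:
  assumes "j \<le> i" "i \<le> g"
  shows "dim_quot (dR_smult T) (pt_omega T X j) (alpha T X j i ` pt_omega T X i)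
       = inv_omega g (\<lambda>i. \<xi> i ` pt_omega T X i) j i"
proof -
  have j: "j \<le> g" using assms by simp
  show ?thesis unfolding dim_quot_def inv_omega_def
    using iso_dim[OF j omega_H1[OF j]] iso_dim[OF j alpha_image_H1[OF assms omega_H1[OF assms(2)]]]
      iso_alpha_image[OF assms omega_H1[OF assms(2)]] by simp
qed

lemma dim_quot_H1:
  assumes "j \<le> i" "i \<le> g"
  shows "dim_quot (dR_smult T) (pt_H1 T X j) (subspace_sum (pt_omega T X j) (alpha T X j i ` pt_H1 T X i))
       = inv_H1 g (\<lambda>i. \<xi> i ` pt_omega T X i) j i"
proof -
  have j: "j \<le> g" using assms by simp
  have surj: "\<xi> l ` pt_H1 T X l = coord_space g" if "l \<le> g" for l
    using bij_betw_imp_surj_on[OF iso_bij[OF that]] .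
  note s = iso_subspace_sum[OF j omega_H1[OF j] alpha_image_H1[OF assms order_refl]]
  show ?thesis unfolding dim_quot_def inv_H1_def
    using iso_dim[OF j order_refl] iso_dim[OF j s(2)] s(1) iso_alpha_image[OF assms order_refl]
      surj[OF j] surj[OF assms(2)] by simp
qed

lemma dim_perp_sum:
  assumes "i \<le> g" "j \<le> g"
  shows "vector_space.dim (dR_smult T)
           (subspace_sum (alpha T X 0 i ` pt_omega T X i) (perp0 T X (alpha T X 0 j ` pt_H1 T X j)))
       = inv_perp g (\<lambda>i. \<xi> i ` pt_omega T X i) i j"
proof -
  have perp: "perp0 T X S \<subseteq> pt_H1 T X 0" for S by (auto simp: perp0_def)
  note s = iso_subspace_sum[OF le0 alpha_image_H1[OF le0 assms(1) omega_H1[OF assms(1)]]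
      perp[of "alpha T X 0 j ` pt_H1 T X j"]]
  show ?thesis unfolding inv_perp_def
    using iso_dim[OF le0 s(2)] s(1) iso_alpha_image[OF le0 assms(1) omega_H1[OF assms(1)]]
      iso_perp0[OF alpha_image_H1[OF le0 assms(2) order_refl]] iso_alpha_image[OF le0 assms(2) order_refl]
      bij_betw_imp_surj_on[OF iso_bij[OF assms(2)]] by simp
qed

text \<open>The Hodge filtration is isotropic of half the dimension at both ends, and the maps of the chain respect it.
  So its image is a half chain to which the normal form applies.\<close>

lemma ex_coordinate_iso:
  "\<exists>\<eta>\<in>chain_isos g (deRham_chain T g X) (lattice_chain p g). \<exists>S.
     \<forall>i\<le>g. S i \<subseteq> {1..2*g} \<and> \<eta> i ` pt_omega T X i = coord_span (S i)"
proof -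
  let ?L = "\<lambda>i. \<xi> i ` pt_omega T X i"
  have sub: "?L i \<subseteq> coord_space g" if "i \<le> g" for i using iso_in[OF that] omega_H1[OF that] by blast
  have st: "chain_step g (int i) x \<in> ?L i" if i: "i < g" and x: "x \<in> ?L (Suc i)" for i x
  proof -
    obtain w where w: "w \<in> pt_omega T X (Suc i)" "x = \<xi> (Suc i) w" using x by blast
    have wH: "w \<in> pt_H1 T X (Suc i)" using w(1) omega_H1[of "Suc i"] i by auto
    have xc: "x \<in> coord_space g" using sub[of "Suc i"] x i by auto
    have "\<xi> i (alpha T X i (Suc i) w) = lat_map p g (- int (Suc i)) (- int i) x"
      using \<xi> i wH w(2) unfolding chain_isos_def by simp
    also have "\<dots> = chain_step g (int i) x" by (rule lat_map_eq_step[OF g p i xc])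
    finally have "chain_step g (int i) x = \<xi> i (alpha T X i (Suc i) w)" ..
    moreover have "dR_pullback T (pt_isog X i) ` pt_omega T X (Suc i) \<subseteq> pt_omega T X i"
      using i by (intro pullback_omega point_facts[OF X] isog_facts[OF X]) auto
    ultimately show ?thesis using w(1) by (auto simp: alpha_Suc alpha_self)
  qed
  have forms: "\<exists>c. \<forall>x\<in>pt_H1 T X 0. \<forall>y\<in>pt_H1 T X 0.
        std_form g (\<xi> 0 x) (\<xi> 0 y) = c * dR_pairing T (pt_av X 0) (pt_pol0 X) x y"
      "\<exists>c. \<forall>x\<in>pt_H1 T X g. \<forall>y\<in>pt_H1 T X g.
        std_form g (\<xi> g x) (\<xi> g y) = c * dR_pairing T (pt_av X g) (pt_polg X) x y"
    using \<xi> unfolding chain_isos_def by (auto simp: lattice_chain_forms[OF g p(1)])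
  have pols: "pt_pol0 X \<in> principal_pols T (pt_av X 0)" "pt_polg X \<in> principal_pols T (pt_av X g)"
    using X by (simp_all add: AI_points_def)
  have iso: "std_form g x y = 0" if i0: "i = 0 \<or> i = g" and xy: "x \<in> ?L i" "y \<in> ?L i" for i x y
  proof -
    have i: "i \<le> g" using i0 by auto
    have "\<exists>c l. l \<in> principal_pols T (pt_av X i) \<and> (\<forall>x\<in>pt_H1 T X i. \<forall>y\<in>pt_H1 T X i.
        std_form g (\<xi> i x) (\<xi> i y) = c * dR_pairing T (pt_av X i) l x y)"
      using i0
    proof
      assume "i = 0"
      thus ?thesis using forms(1) pols(1) by simp blast
    next
      assume "i = g"
      thus ?thesis using forms(2) pols(2) by simp blast
    qed
    then obtain c l where cl: "l \<in> principal_pols T (pt_av X i)"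
       "\<forall>x\<in>pt_H1 T X i. \<forall>y\<in>pt_H1 T X i. std_form g (\<xi> i x) (\<xi> i y) = c * dR_pairing T (pt_av X i) l x y"
      by blast
    obtain v w where vw: "v \<in> pt_omega T X i" "w \<in> pt_omega T X i" "x = \<xi> i v" "y = \<xi> i w"
      using xy by blast
    have "std_form g x y = c * dR_pairing T (pt_av X i) l v w"
      using cl(2) vw omega_H1[OF i] by blast
    thus ?thesis using omega_isotropic[OF point_facts(1)[OF X i] cl(1) vw(1,2)] by simp
  qed
  have "\<exists>\<gamma>\<in>G_I p g. \<exists>S. \<forall>i\<le>g. S i \<subseteq> {1..2*g} \<and> \<gamma> i ` ?L i = coord_span (S i)"
  proof (rule coordinate_normal_form[OF g p])
    show "std_perp g (?L 0) = ?L 0" using iso[of 0] by (intro lagrangian iso_subspace sub dim_iso_omega) auto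
    show "std_perp g (?L g) = ?L g" using iso[of g] by (intro lagrangian iso_subspace sub dim_iso_omega) auto
  qed (use iso_subspace sub st in auto)
  then obtain \<gamma> S where \<gamma>: "\<gamma> \<in> G_I p g" "\<forall>i\<le>g. S i \<subseteq> {1..2*g} \<and> \<gamma> i ` ?L i = coord_span (S i)" by blast
  have "(\<lambda>i x. \<gamma> i (\<xi> i x)) \<in> chain_isos g (deRham_chain T g X) (lattice_chain p g)"
    using chain_isos_comp[OF \<xi>] \<gamma>(1) unfolding G_I_def by blast
  thus ?thesis using \<gamma>(2) by (intro bexI[of _ "\<lambda>i x. \<gamma> i (\<xi> i x)"] exI[of _ S]) (simp_all add: image_image)
qed

end

end

lemma id_in_G_I: "(\<lambda>i x. x) \<in> G_I p g"
  by (auto simp: G_I_def chain_isos_def linear_on_def bij_betw_def intro: exI[of _ 1])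

text \<open>Equal orbits mean that one chain is a translate of the other, and the translation can be absorbed into the
  trivialisation.\<close>

lemma same_KR_stratum_iff:
  fixes T :: "('k::field, 'a, 'm, 'l, 'q, 'v::ab_group_add) av_deRham"
  shows "same_KR_stratum T p g X X' \<longleftrightarrow>
    (\<exists>\<xi> \<in> chain_isos g (deRham_chain T g X) (lattice_chain p g).
      \<exists>\<xi>' \<in> chain_isos g (deRham_chain T g X') (lattice_chain p g).
        \<forall>i\<le>g. \<xi> i ` pt_omega T X i = \<xi>' i ` pt_omega T X' i)" (is "_ \<longleftrightarrow> ?R")
proof
  assume "same_KR_stratum T p g X X'"
  then obtain \<xi> \<xi>' where \<xi>: "\<xi> \<in> chain_isos g (deRham_chain T g X) (lattice_chain p g)"
    "\<xi>' \<in> chain_isos g (deRham_chain T g X') (lattice_chain p g)"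
    "G_I_orbit p g (\<lambda>i. \<xi> i ` pt_omega T X i) = G_I_orbit p g (\<lambda>i. \<xi>' i ` pt_omega T X' i)"
    unfolding same_KR_stratum_def by blast
  have "(\<lambda>i\<in>{..g}. \<xi> i ` pt_omega T X i) \<in> G_I_orbit p g (\<lambda>i. \<xi> i ` pt_omega T X i)"
    unfolding G_I_orbit_def by (rule image_eqI[OF _ id_in_G_I]) simp
  hence "(\<lambda>i\<in>{..g}. \<xi> i ` pt_omega T X i) \<in> G_I_orbit p g (\<lambda>i. \<xi>' i ` pt_omega T X' i)"
    by (simp only: \<xi>(3))
  then obtain \<gamma> where \<gamma>: "\<gamma> \<in> G_I p g"
    "(\<lambda>i\<in>{..g}. \<xi> i ` pt_omega T X i) = (\<lambda>i\<in>{..g}. \<gamma> i ` \<xi>' i ` pt_omega T X' i)"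
    unfolding G_I_orbit_def by (rule imageE)
  have "\<xi> i ` pt_omega T X i = \<gamma> i ` \<xi>' i ` pt_omega T X' i" if "i \<le> g" for i
    using fun_cong[OF \<gamma>(2), of i] that by simp
  moreover have "(\<lambda>i x. \<gamma> i (\<xi>' i x)) \<in> chain_isos g (deRham_chain T g X') (lattice_chain p g)"
    using chain_isos_comp[OF \<xi>(2)] \<gamma>(1) unfolding G_I_def by blast
  ultimately show ?R using \<xi>(1)
    by (intro bexI[of _ \<xi>] bexI[of _ "\<lambda>i x. \<gamma> i (\<xi>' i x)"]) (simp_all add: image_image)
next
  assume ?R
  then obtain \<xi> \<xi>' where \<xi>: "\<xi> \<in> chain_isos g (deRham_chain T g X) (lattice_chain p g)"
    "\<xi>' \<in> chain_isos g (deRham_chain T g X') (lattice_chain p g)"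
    "\<And>i. i \<le> g \<Longrightarrow> \<xi> i ` pt_omega T X i = \<xi>' i ` pt_omega T X' i" by blast
  have "G_I_orbit p g (\<lambda>i. \<xi> i ` pt_omega T X i) = G_I_orbit p g (\<lambda>i. \<xi>' i ` pt_omega T X' i)"
    unfolding G_I_orbit_def by (rule image_cong[OF refl], rule restrict_ext) (simp only: \<xi>(3) atMost_iff)
  thus "same_KR_stratum T p g X X'" unfolding same_KR_stratum_def using \<xi>(1,2) by blast
qed

theorem theorem1p1:
  fixes T :: "('k::alg_closed_field, 'a, 'm, 'l, 'q, 'v::ab_group_add) av_deRham"
    and p g N :: nat and \<zeta> :: 'k
    and X X' :: "('a, 'm, 'l, 'q) AI_tuple"
  assumes "prime p" and "g \<ge> 1" and "N \<ge> 3" and "coprime N p"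
    and "is_Fp_closure p TYPE('k)"
    and "primitive_root_of_unity N \<zeta>"
    and "av_deRham_theory T p g N \<zeta>"
    and "X \<in> AI_points T p g N \<zeta>" and "X' \<in> AI_points T p g N \<zeta>"
  shows "same_KR_stratum T p g X X' \<longleftrightarrow>
    (\<forall>i\<le>g. \<forall>j<i.
       dim_quot (dR_smult T) (pt_omega T X j) (alpha T X j i ` pt_omega T X i) =
       dim_quot (dR_smult T) (pt_omega T X' j) (alpha T X' j i ` pt_omega T X' i)) \<and>
    (\<forall>i\<le>g. \<forall>j<i.
       dim_quot (dR_smult T) (pt_H1 T X j)
         (subspace_sum (pt_omega T X j) (alpha T X j i ` pt_H1 T X i)) =
       dim_quot (dR_smult T) (pt_H1 T X' j)
         (subspace_sum (pt_omega T X' j) (alpha T X' j i ` pt_H1 T X' i))) \<and>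
    (\<forall>i\<le>g. \<forall>j\<le>g.
       vector_space.dim (dR_smult T)
         (subspace_sum (alpha T X 0 i ` pt_omega T X i)
            (perp0 T X (alpha T X 0 j ` pt_H1 T X j))) =
       vector_space.dim (dR_smult T)
         (subspace_sum (alpha T X' 0 i ` pt_omega T X' i)
            (perp0 T X' (alpha T X' 0 j ` pt_H1 T X' j))))"
    (is "_ \<longleftrightarrow> ?A \<and> ?B \<and> ?C")
proof -
  interpret av_deRham_theory T p g N \<zeta> by fact
  note g = \<open>g \<ge> 1\<close> and X = \<open>X \<in> AI_points T p g N \<zeta>\<close> and X' = \<open>X' \<in> AI_points T p g N \<zeta>\<close>
  have p: "p > 0" "CHAR('k) = p"
    using \<open>prime p\<close> \<open>is_Fp_closure p TYPE('k)\<close> by (auto simp: is_Fp_closure_def prime_gt_0_nat)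
  define L where "L = (\<lambda>Y \<xi> i. \<xi> i ` pt_omega T Y i :: (nat \<Rightarrow> 'k) set)"
  have ABC: "?A \<and> ?B \<and> ?C \<longleftrightarrow>
      (\<forall>i\<le>g. \<forall>j<i. inv_omega g (L X \<xi>) j i = inv_omega g (L X' \<xi>') j i) \<and>
      (\<forall>i\<le>g. \<forall>j<i. inv_H1 g (L X \<xi>) j i = inv_H1 g (L X' \<xi>') j i) \<and>
      (\<forall>i\<le>g. \<forall>j\<le>g. inv_perp g (L X \<xi>) i j = inv_perp g (L X' \<xi>') i j)"
    if "\<xi> \<in> chain_isos g (deRham_chain T g X) (lattice_chain p g)"
      "\<xi>' \<in> chain_isos g (deRham_chain T g X') (lattice_chain p g)" for \<xi> \<xi>'
    unfolding L_def
    using dim_quot_omega[OF g p X that(1)] dim_quot_omega[OF g p X' that(2)]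
      dim_quot_H1[OF g p X that(1)] dim_quot_H1[OF g p X' that(2)]
      dim_perp_sum[OF g p X that(1)] dim_perp_sum[OF g p X' that(2)] by (simp add: less_imp_le)
  show ?thesis
  proof
    assume "same_KR_stratum T p g X X'"
    then obtain \<xi> \<xi>' where \<xi>: "\<xi> \<in> chain_isos g (deRham_chain T g X) (lattice_chain p g)"
      "\<xi>' \<in> chain_isos g (deRham_chain T g X') (lattice_chain p g)"
      "\<And>i. i \<le> g \<Longrightarrow> L X \<xi> i = L X' \<xi>' i"
      unfolding same_KR_stratum_iff L_def by blast
    show "?A \<and> ?B \<and> ?C" unfolding ABC[OF \<xi>(1,2)] using \<xi>(3) by (simp add: inv_omega_def inv_H1_def inv_perp_def)
  next
    assume inv: "?A \<and> ?B \<and> ?C"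
    obtain \<xi>0 \<xi>0' where \<xi>0: "\<xi>0 \<in> chain_isos g (deRham_chain T g X) (lattice_chain p g)"
      "\<xi>0' \<in> chain_isos g (deRham_chain T g X') (lattice_chain p g)"
      using lattice_chain_iso[OF X] lattice_chain_iso[OF X'] by blast
    obtain \<xi> S where \<xi>: "\<xi> \<in> chain_isos g (deRham_chain T g X) (lattice_chain p g)"
      "\<forall>i\<le>g. S i \<subseteq> {1..2*g} \<and> L X \<xi> i = coord_span (S i)"
      using ex_coordinate_iso[OF g p X \<xi>0(1)] unfolding L_def by blast
    obtain \<xi>' S' where \<xi>': "\<xi>' \<in> chain_isos g (deRham_chain T g X') (lattice_chain p g)"
      "\<forall>i\<le>g. S' i \<subseteq> {1..2*g} \<and> L X' \<xi>' i = coord_span (S' i)"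
      using ex_coordinate_iso[OF g p X' \<xi>0(2)] unfolding L_def by blast
    have "L X \<xi> i = L X' \<xi>' i" if "i \<le> g" for i
    proof (rule coordinate_chains_eqI[OF _ _ _ _ _ that])
      show "\<forall>i\<le>g. S i \<subseteq> {1..2*g} \<and> L X \<xi> i = coord_span (S i) \<and> cv.dim (L X \<xi> i) = g"
        using \<xi>(2) dim_iso_omega[OF g p X \<xi>(1)] unfolding L_def by blast
      show "\<forall>i\<le>g. S' i \<subseteq> {1..2*g} \<and> L X' \<xi>' i = coord_span (S' i) \<and> cv.dim (L X' \<xi>' i) = g"
        using \<xi>'(2) dim_iso_omega[OF g p X' \<xi>'(1)] unfolding L_def by blast
    qed (use inv ABC[OF \<xi>(1) \<xi>'(1)] in blast)+
    thus "same_KR_stratum T p g X X'" unfolding same_KR_stratum_iff L_def using \<xi>(1) \<xi>'(1) by blast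
  qed
qed

end
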